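(* Let $p$ be a prime number, let $H$ be a finite group and let $N_1$ and $N_2$ be two invertible $\mathbb{Z}_{(p)}[H]$-modules. If $N_1\otimes\mathbb{Z}/p\mathbb{Z}\simeq N_2\otimes\mathbb{Z}/p\mathbb{Z}$ (as $(\mathbb{Z}/p\mathbb{Z})[H]$-modules), then $N_1\simeq N_2$ (as $\mathbb{Z}_{(p)}[H]$-modules).
   Context: $\mathbb{Z}_{(p)}$ is the localization of $\mathbb{Z}$ at $p$. A permutation $\mathbb{Z}_{(p)}[H]$-module is a $\mathbb{Z}_{(p)}[H]$-module that is free of finite rank over $\mathbb{Z}_{(p)}$ with a $\mathbb{Z}_{(p)}$-basis permuted by $H$. An invertible $\mathbb{Z}_{(p)}[H]$-module is a direct summand of a permutation $\mathbb{Z}_{(p)}[H]$-module. *)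

theory Defs
  imports "HOL-Algebra.Group_Action" "HOL-Algebra.Free_Abelian_Groups" "HOL-Algebra.Module" "HOL-Number_Theory.Residues"
begin

definition Z_loc :: "nat \<Rightarrow> rat ring"
  where "Z_loc p =
    \<lparr>carrier = {of_int a / of_int b | a b. \<not> int p dvd b},
     monoid.mult = (*), one = 1, ring.zero = 0, add = (+)\<rparr>"

(* An R[H]-module is encoded as an R-module together with an R-linear action of the group H.
   Only the values of the action on carrier H and carrier M matter; the restriction in the
   locale is there because group_action demands extensional functions. *)

record ('r, 'm, 'h) gmodule = "('r, 'm) module" +
  act :: "'h \<Rightarrow> 'm \<Rightarrow> 'm"

locale group_ring_module = module R M + action: group_action H "carrier M" "\<lambda>h. restrict (act M h) (carrier M)"
  for R :: "('r, 'i) ring_scheme" (structure)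
    and H :: "('h, 'j) monoid_scheme" (structure)
    and M :: "('r, 'm, 'h, 'k) gmodule_scheme" (structure) +
  assumes act_add: "\<lbrakk>h \<in> carrier H; x \<in> carrier M; y \<in> carrier M\<rbrakk>
      \<Longrightarrow> act M h (x \<oplus>\<^bsub>M\<^esub> y) = act M h x \<oplus>\<^bsub>M\<^esub> act M h y"
    and act_smult: "\<lbrakk>h \<in> carrier H; r \<in> carrier R; x \<in> carrier M\<rbrakk>
      \<Longrightarrow> act M h (r \<odot>\<^bsub>M\<^esub> x) = r \<odot>\<^bsub>M\<^esub> act M h x"

definition gmodule_isomorphic ::
    "('r, 'i) ring_scheme \<Rightarrow> ('h, 'j) monoid_scheme \<Rightarrow> ('r, 'm, 'h, 'k) gmodule_scheme \<Rightarrow>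
     ('r, 'n, 'h, 'l) gmodule_scheme \<Rightarrow> bool"
  where "gmodule_isomorphic R H M N \<longleftrightarrow>
    (\<exists>f \<in> iso (add_monoid M) (add_monoid N).
      (\<forall>r \<in> carrier R. \<forall>x \<in> carrier M. f (r \<odot>\<^bsub>M\<^esub> x) = r \<odot>\<^bsub>N\<^esub> f x) \<and>
      (\<forall>h \<in> carrier H. \<forall>x \<in> carrier M. f (act M h x) = act N h (f x)))"

definition finite_basis ::
    "('r, 'i) ring_scheme \<Rightarrow> ('r, 'm, 'k) module_scheme \<Rightarrow> 'm set \<Rightarrow> bool"
  where "finite_basis R M B \<longleftrightarrow> finite B \<and> B \<subseteq> carrier M \<and>
    (\<forall>x \<in> carrier M. \<exists>!c. c \<in> B \<rightarrow>\<^sub>E carrier R \<and> x = (\<Oplus>\<^bsub>M\<^esub>b\<in>B. c b \<odot>\<^bsub>M\<^esub> b))"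

definition permutation_gmodule ::
    "('r, 'i) ring_scheme \<Rightarrow> ('h, 'j) monoid_scheme \<Rightarrow> ('r, 'm, 'h, 'k) gmodule_scheme \<Rightarrow> bool"
  where "permutation_gmodule R H P \<longleftrightarrow> group_ring_module R H P \<and>
    (\<exists>B. finite_basis R P B \<and> (\<forall>h \<in> carrier H. act P h ` B = B))"

definition sub_gmodule ::
    "('r, 'i) ring_scheme \<Rightarrow> ('h, 'j) monoid_scheme \<Rightarrow> ('r, 'm, 'h, 'k) gmodule_scheme \<Rightarrow> 'm set \<Rightarrow> bool"
  where "sub_gmodule R H M A \<longleftrightarrow> submodule A R M \<and> (\<forall>h \<in> carrier H. act M h ` A \<subseteq> A)"

definition direct_summand ::
    "('r, 'i) ring_scheme \<Rightarrow> ('h, 'j) monoid_scheme \<Rightarrow> ('r, 'm, 'h, 'k) gmodule_scheme \<Rightarrow>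
     ('r, 'n, 'h, 'l) gmodule_scheme \<Rightarrow> bool"
  where "direct_summand R H N P \<longleftrightarrow>
    (\<exists>A B. sub_gmodule R H P A \<and> sub_gmodule R H P B \<and>
       A \<inter> B = {\<zero>\<^bsub>P\<^esub>} \<and> A <+>\<^bsub>P\<^esub> B = carrier P \<and>
       gmodule_isomorphic R H N (P\<lparr>carrier := A\<rparr>))"

(* A definition cannot quantify over types, so the type 'c of the elements of the ambient
   permutation module is a parameter; leave 'c free to allow an arbitrary permutation module. *)
definition invertible_gmodule ::
    "'c itself \<Rightarrow> ('r, 'i) ring_scheme \<Rightarrow> ('h, 'j) monoid_scheme \<Rightarrow>
     ('r, 'm, 'h, 'k) gmodule_scheme \<Rightarrow> bool"
  where "invertible_gmodule T R H N \<longleftrightarrow> group_ring_module R H N \<and>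
    (\<exists>P :: ('r, 'c, 'h) gmodule. permutation_gmodule R H P \<and> direct_summand R H N P)"

(* The tensor product over the integers of the additive groups of M and K: the free abelian group
   on pairs modulo the subgroup generated by the biadditivity relations. Here frag_of (x, a) is the
   generator belonging to (x, a), and its coset is the pure tensor of x and a. *)

abbreviation pairs_group ::
    "('m, 'i) ring_scheme \<Rightarrow> ('s, 'j) ring_scheme \<Rightarrow> ('m \<times> 's \<Rightarrow>\<^sub>0 int) monoid"
  where "pairs_group M K \<equiv> free_Abelian_group (carrier M \<times> carrier K)"

definition tensor_relations ::
    "('m, 'i) ring_scheme \<Rightarrow> ('s, 'j) ring_scheme \<Rightarrow> ('m \<times> 's \<Rightarrow>\<^sub>0 int) set"
  where "tensor_relations M K = generate (pairs_group M K)
    ({frag_of (x \<oplus>\<^bsub>M\<^esub> y, a) - frag_of (x, a) - frag_of (y, a) | x y a.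
        x \<in> carrier M \<and> y \<in> carrier M \<and> a \<in> carrier K} \<union>
     {frag_of (x, a \<oplus>\<^bsub>K\<^esub> b) - frag_of (x, a) - frag_of (x, b) | x a b.
        x \<in> carrier M \<and> a \<in> carrier K \<and> b \<in> carrier K})"

definition tensor_group ::
    "('m, 'i) ring_scheme \<Rightarrow> ('s, 'j) ring_scheme \<Rightarrow> ('m \<times> 's \<Rightarrow>\<^sub>0 int) set monoid"
  where "tensor_group M K = pairs_group M K Mod tensor_relations M K"

(* The endomorphism induced by additive maps f of M and g of K. The union is over the
   representatives of the coset X and does not depend on them: all of them give the same coset. *)
definition tensor_map ::
    "('m, 'i) ring_scheme \<Rightarrow> ('s, 'j) ring_scheme \<Rightarrow> ('m \<Rightarrow> 'm) \<Rightarrow> ('s \<Rightarrow> 's) \<Rightarrow>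
     ('m \<times> 's \<Rightarrow>\<^sub>0 int) set \<Rightarrow> ('m \<times> 's \<Rightarrow>\<^sub>0 int) set"
  where "tensor_map M K f g X =
    (\<Union>u\<in>X. tensor_relations M K #>\<^bsub>pairs_group M K\<^esub> frag_extend (\<lambda>(x, a). frag_of (f x, g a)) u)"

(* For a commutative ring K, a K[H]-module: K acts on the right factor and H on the left one.
   The multiplicative fields of the record play no role for modules. *)
definition tensor_gmodule ::
    "('r, 'm, 'h, 'k) gmodule_scheme \<Rightarrow> ('s, 'j) ring_scheme \<Rightarrow>
     ('s, ('m \<times> 's \<Rightarrow>\<^sub>0 int) set, 'h) gmodule"
  where "tensor_gmodule M K =
    \<lparr>carrier = carrier (tensor_group M K), monoid.mult = undefined, one = undefined,
     ring.zero = \<one>\<^bsub>tensor_group M K\<^esub>, add = (\<otimes>\<^bsub>tensor_group M K\<^esub>),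
     smult = (\<lambda>c. tensor_map M K id (\<lambda>a. c \<otimes>\<^bsub>K\<^esub> a)),
     act = (\<lambda>h. tensor_map M K (act M h) id)\<rparr>"

end

theory Submission
  imports Defs
begin

text \<open>
  Write \<open>R\<close> for the localization of the integers at \<open>p\<close>. An isomorphism
  \<open>N1 / p N1 \<simeq> N2 / p N2\<close> lifts to an \<open>R[H]\<close>-linear map \<open>f\<close> from \<open>N1\<close> to \<open>N2\<close>, and every
  such lift is bijective.

  The lift exists because \<open>N1\<close> and \<open>N2\<close> are direct summands of permutation modules. Such a
  module \<open>N\<close> inherits from its ambient module a finite family \<open>e x\<close> permuted by \<open>H\<close> and linear
  coordinates \<open>c n x\<close> that are permuted along with it, such that \<open>n\<close> is the sum of the
  \<open>c n x \<cdot> e x\<close> (locale \<open>permutation_frame\<close>). Replacing each coordinate by a chosen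
  representative of its class modulo \<open>p\<close> gives a section \<open>N / p N \<rightarrow> N\<close> that is not additive but
  commutes with \<open>H\<close>, because permuting coordinates commutes with applying one function to
  all of them (\<open>residue_section_act\<close>). To lift, send \<open>e1 x\<close> to the value of this section
  for \<open>N2\<close> at the image of its class, and extend linearly through the coordinates of \<open>N1\<close>
  (\<open>equivariant_lift\<close>).

  If \<open>f n = 0\<close>, then \<open>n = p n'\<close> since \<open>f\<close> is injective modulo \<open>p\<close>, and \<open>f n' = 0\<close> since \<open>N2\<close> is
  torsion free; so \<open>n\<close> is divisible by all powers of \<open>p\<close> and vanishes (\<open>lift_injective\<close>).
  Surjectivity is Nakayama's lemma (\<open>lift_surjective\<close>). This part of the argument works over
  every commutative ring with a regular element \<open>\<pi>\<close> of the Jacobson radical whose powers have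
  no common nonzero multiple, and it is carried out in that generality
  (\<open>residue_correspondence_lifts\<close>).

  What remains is to read the tensor product with the integers modulo \<open>p\<close> as \<open>N / p N\<close>: every
  tensor is a pure tensor of some \<open>x\<close> with \<open>1\<close>, and \<open>x\<close> is determined up to \<open>p N\<close>
  (\<open>tensor_one_surj\<close>, \<open>tensor_one_eq_iff\<close>).
\<close>

section \<open>Nakayama's lemma\<close>

lemma (in module) submodule_add_multiples:
  assumes T: "submodule T R M" and d: "d \<in> carrier M"
  shows "submodule {t \<oplus>\<^bsub>M\<^esub> a \<odot>\<^bsub>M\<^esub> d | t a. t \<in> T \<and> a \<in> carrier R} R M" (is "submodule ?T' R M")
proof -
  note TE = submoduleE[OF T]
  have TM: "\<And>t. t \<in> T \<Longrightarrow> t \<in> carrier M" using TE(1) by blast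
  have T0: "\<zero>\<^bsub>M\<^esub> \<in> T"
    using T by (metis monoid.select_convs(2) submodule.axioms(1) subgroup.one_closed)
  show ?thesis
  proof (rule submoduleI)
    show "?T' \<subseteq> carrier M" using TM d by auto
    show "\<zero>\<^bsub>M\<^esub> \<in> ?T'"
      using T0 d by (auto intro!: exI[of _ "\<zero>\<^bsub>M\<^esub>"] exI[of _ "\<zero>\<^bsub>R\<^esub>"])
  next
    fix u assume "u \<in> ?T'"
    then obtain t a where t: "t \<in> T" "a \<in> carrier R" "u = t \<oplus>\<^bsub>M\<^esub> a \<odot>\<^bsub>M\<^esub> d" by blast
    have "\<ominus>\<^bsub>M\<^esub> u = \<ominus>\<^bsub>M\<^esub> t \<oplus>\<^bsub>M\<^esub> (\<ominus>\<^bsub>R\<^esub> a) \<odot>\<^bsub>M\<^esub> d"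
      using t d TM by (simp add: smult_l_minus M.minus_add)
    then show "\<ominus>\<^bsub>M\<^esub> u \<in> ?T'" using TE(3) t by blast
  next
    fix u v assume "u \<in> ?T'" "v \<in> ?T'"
    then obtain t a s b where *: "t \<in> T" "a \<in> carrier R" "u = t \<oplus>\<^bsub>M\<^esub> a \<odot>\<^bsub>M\<^esub> d"
       "s \<in> T" "b \<in> carrier R" "v = s \<oplus>\<^bsub>M\<^esub> b \<odot>\<^bsub>M\<^esub> d" by blast
    then have "u \<oplus>\<^bsub>M\<^esub> v = (t \<oplus>\<^bsub>M\<^esub> s) \<oplus>\<^bsub>M\<^esub> (a \<oplus>\<^bsub>R\<^esub> b) \<odot>\<^bsub>M\<^esub> d"
      using TM d by (simp add: smult_l_distr M.a_ac)
    then show "u \<oplus>\<^bsub>M\<^esub> v \<in> ?T'" using TE(5) * by blast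
  next
    fix r u assume r: "r \<in> carrier R" and "u \<in> ?T'"
    then obtain t a where t: "t \<in> T" "a \<in> carrier R" "u = t \<oplus>\<^bsub>M\<^esub> a \<odot>\<^bsub>M\<^esub> d" by blast
    have "r \<odot>\<^bsub>M\<^esub> u = r \<odot>\<^bsub>M\<^esub> t \<oplus>\<^bsub>M\<^esub> (r \<otimes>\<^bsub>R\<^esub> a) \<odot>\<^bsub>M\<^esub> d"
      using t d r TM by (simp add: smult_r_distr smult_assoc1)
    then show "r \<odot>\<^bsub>M\<^esub> u \<in> ?T'" using TE(4) t r by blast
  qed
qed

text \<open>
  Generators are adjoined to \<open>S\<close> one at a time, so it is enough to treat a single one, \<open>d\<close>.
  By induction every element has the form \<open>t + a d\<close> with \<open>t\<close> in \<open>S\<close>. Write \<open>d = s + \<pi> n\<close> with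
  \<open>s\<close> in \<open>S\<close>, and \<open>n\<close> in that form; then \<open>(1 - \<pi> a) d\<close> lies in \<open>S\<close>, and so does \<open>d\<close>. That \<open>C\<close> generates modulo \<open>S\<close> is expressed through the submodules that
  contain both, which keeps linear combinations out of the induction.
\<close>
lemma (in module) nakayama:
  assumes \<pi>: "\<pi> \<in> carrier R"
    and unit: "\<And>a. a \<in> carrier R \<Longrightarrow> \<one>\<^bsub>R\<^esub> \<ominus>\<^bsub>R\<^esub> \<pi> \<otimes>\<^bsub>R\<^esub> a \<in> Units R"
    and "finite C" and "C \<subseteq> carrier M"
    and "\<And>U. submodule U R M \<Longrightarrow> S \<union> C \<subseteq> U \<Longrightarrow> U = carrier M"
    and "submodule S R M"
    and "\<And>x. x \<in> carrier M \<Longrightarrow> \<exists>s\<in>S. \<exists>y\<in>carrier M. x = s \<oplus>\<^bsub>M\<^esub> \<pi> \<odot>\<^bsub>M\<^esub> y"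
  shows "S = carrier M"
  using assms(3-)
proof (induction C arbitrary: S)
  case empty
  then show ?case by simp
next
  case (insert d C)
  note S = insert.prems(3) and cover = insert.prems(4)
  note SE = submoduleE[OF S]
  have d: "d \<in> carrier M" using insert.prems by simp
  have SM: "\<And>t. t \<in> S \<Longrightarrow> t \<in> carrier M" using SE(1) by blast
  let ?S' = "{t \<oplus>\<^bsub>M\<^esub> a \<odot>\<^bsub>M\<^esub> d | t a. t \<in> S \<and> a \<in> carrier R}"
  have S': "submodule ?S' R M" by (rule submodule_add_multiples[OF S d])
  have S0: "\<zero>\<^bsub>M\<^esub> \<in> S"
    using S by (metis monoid.select_convs(2) submodule.axioms(1) subgroup.one_closed)
  have sub: "S \<subseteq> ?S'"
  proof
    fix s assume s: "s \<in> S"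
    then have "s = s \<oplus>\<^bsub>M\<^esub> \<zero>\<^bsub>R\<^esub> \<odot>\<^bsub>M\<^esub> d" using d SM by simp
    then show "s \<in> ?S'" using s by blast
  qed
  have "d = \<zero>\<^bsub>M\<^esub> \<oplus>\<^bsub>M\<^esub> \<one>\<^bsub>R\<^esub> \<odot>\<^bsub>M\<^esub> d" using d by simp
  then have d': "d \<in> ?S'" using S0 by blast
  have "?S' = carrier M"
  proof (rule insert.IH[OF _ _ S'])
    show "C \<subseteq> carrier M" using insert.prems by simp
    show "U = carrier M" if "submodule U R M" "?S' \<union> C \<subseteq> U" for U
      using insert.prems(2)[OF that(1)] that(2) sub d' by blast
    show "\<exists>s\<in>?S'. \<exists>y\<in>carrier M. x = s \<oplus>\<^bsub>M\<^esub> \<pi> \<odot>\<^bsub>M\<^esub> y" if "x \<in> carrier M" for x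
      using cover[OF that] sub by blast
  qed
  obtain s n where s: "s \<in> S" and n: "n \<in> carrier M" and dsn: "d = s \<oplus>\<^bsub>M\<^esub> \<pi> \<odot>\<^bsub>M\<^esub> n"
    using cover[OF d] by blast
  obtain t a where t: "t \<in> S" and a: "a \<in> carrier R" and nta: "n = t \<oplus>\<^bsub>M\<^esub> a \<odot>\<^bsub>M\<^esub> d"
    using n \<open>?S' = carrier M\<close> by blast
  let ?u = "\<one>\<^bsub>R\<^esub> \<ominus>\<^bsub>R\<^esub> \<pi> \<otimes>\<^bsub>R\<^esub> a"
  have u: "?u \<in> Units R" using unit a .
  have "?u \<odot>\<^bsub>M\<^esub> d = d \<ominus>\<^bsub>M\<^esub> (\<pi> \<otimes>\<^bsub>R\<^esub> a) \<odot>\<^bsub>M\<^esub> d"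
    using a \<pi> d by (simp add: R.minus_eq M.minus_eq smult_l_distr smult_l_minus)
  also have "\<dots> = s \<oplus>\<^bsub>M\<^esub> \<pi> \<odot>\<^bsub>M\<^esub> t"
  proof -
let ?v = "s \<oplus>\<^bsub>M\<^esub> \<pi> \<odot>\<^bsub>M\<^esub> t" and ?w = "(\<pi> \<otimes>\<^bsub>R\<^esub> a) \<odot>\<^bsub>M\<^esub> d"
    have vw: "?v \<in> carrier M" "?w \<in> carrier M" using s t a d \<pi> SM by auto
    have "d = s \<oplus>\<^bsub>M\<^esub> \<pi> \<odot>\<^bsub>M\<^esub> (t \<oplus>\<^bsub>M\<^esub> a \<odot>\<^bsub>M\<^esub> d)"
      using dsn nta by simp
    also have "\<dots> = ?v \<oplus>\<^bsub>M\<^esub> ?w"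
      using s t a d \<pi> SM by (simp add: smult_r_distr smult_assoc1 M.a_assoc)
    finally have "d \<ominus>\<^bsub>M\<^esub> ?w = (?v \<oplus>\<^bsub>M\<^esub> ?w) \<ominus>\<^bsub>M\<^esub> ?w" by (rule arg_cong)
    also have "\<dots> = ?v"
      using vw by (simp add: M.minus_eq M.a_assoc M.r_neg del: smult_closed)
    finally show ?thesis .
  qed
  finally have "?u \<odot>\<^bsub>M\<^esub> d \<in> S" using s t \<pi> SE(4,5) by simp
  then have "inv\<^bsub>R\<^esub> ?u \<odot>\<^bsub>M\<^esub> (?u \<odot>\<^bsub>M\<^esub> d) \<in> S" using u SE(4) by simp
  moreover have "inv\<^bsub>R\<^esub> ?u \<odot>\<^bsub>M\<^esub> (?u \<odot>\<^bsub>M\<^esub> d) = d"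
    using u d smult_assoc1[of "inv\<^bsub>R\<^esub> ?u" ?u d] by (simp add: R.Units_closed)
  ultimately have "d \<in> S" by simp
  then have "?S' \<subseteq> S" using SE(4,5) by blast
  then have "?S' = S" using sub by (rule subset_antisym)
  then show ?case using \<open>?S' = carrier M\<close> by simp
qed

section \<open>Linear maps that commute with a group action\<close>

definition equivariant_maps ::
    "('r, 'i) ring_scheme \<Rightarrow> ('h, 'j) monoid_scheme \<Rightarrow> ('r, 'm, 'h, 'k) gmodule_scheme \<Rightarrow>
     ('r, 'n, 'h, 'l) gmodule_scheme \<Rightarrow> ('m \<Rightarrow> 'n) set"
  where "equivariant_maps R H M N = {f \<in> carrier M \<rightarrow> carrier N.
    (\<forall>x \<in> carrier M. \<forall>y \<in> carrier M. f (x \<oplus>\<^bsub>M\<^esub> y) = f x \<oplus>\<^bsub>N\<^esub> f y) \<and>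
    (\<forall>r \<in> carrier R. \<forall>x \<in> carrier M. f (r \<odot>\<^bsub>M\<^esub> x) = r \<odot>\<^bsub>N\<^esub> f x) \<and>
    (\<forall>h \<in> carrier H. \<forall>x \<in> carrier M. f (act M h x) = act N h (f x))}"

lemma gmodule_isomorphic_iff:
  "gmodule_isomorphic R H M N \<longleftrightarrow>
    (\<exists>f \<in> equivariant_maps R H M N. bij_betw f (carrier M) (carrier N))"
  unfolding gmodule_isomorphic_def equivariant_maps_def iso_def hom_def by auto

lemma
  assumes "f \<in> equivariant_maps R H M N"
  shows equivariant_maps_closed: "x \<in> carrier M \<Longrightarrow> f x \<in> carrier N"
    and equivariant_maps_add: "\<lbrakk>x \<in> carrier M; y \<in> carrier M\<rbrakk> \<Longrightarrow> f (x \<oplus>\<^bsub>M\<^esub> y) = f x \<oplus>\<^bsub>N\<^esub> f y"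
    and equivariant_maps_smult: "\<lbrakk>r \<in> carrier R; x \<in> carrier M\<rbrakk> \<Longrightarrow> f (r \<odot>\<^bsub>M\<^esub> x) = r \<odot>\<^bsub>N\<^esub> f x"
    and equivariant_maps_act: "\<lbrakk>h \<in> carrier H; x \<in> carrier M\<rbrakk> \<Longrightarrow> f (act M h x) = act N h (f x)"
  using assms unfolding equivariant_maps_def by auto

lemma additive_zero:
  assumes "abelian_group M" "abelian_group N" "f \<in> carrier M \<rightarrow> carrier N"
    "\<And>x y. \<lbrakk>x \<in> carrier M; y \<in> carrier M\<rbrakk> \<Longrightarrow> f (x \<oplus>\<^bsub>M\<^esub> y) = f x \<oplus>\<^bsub>N\<^esub> f y"
  shows "f \<zero>\<^bsub>M\<^esub> = \<zero>\<^bsub>N\<^esub>"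
proof -
  interpret M: abelian_group M by fact
  interpret N: abelian_group N by fact
  have "f \<zero>\<^bsub>M\<^esub> \<oplus>\<^bsub>N\<^esub> f \<zero>\<^bsub>M\<^esub> = f \<zero>\<^bsub>M\<^esub>" using assms(4)[of "\<zero>\<^bsub>M\<^esub>" "\<zero>\<^bsub>M\<^esub>"] by simp
  then show ?thesis using assms(3) M.zero_closed N.add.l_cancel_one[of "f \<zero>\<^bsub>M\<^esub>" "f \<zero>\<^bsub>M\<^esub>"] by blast
qed

lemma additive_finsum:
  assumes "abelian_group M" "abelian_group N" "f \<in> carrier M \<rightarrow> carrier N"
    "\<And>x y. \<lbrakk>x \<in> carrier M; y \<in> carrier M\<rbrakk> \<Longrightarrow> f (x \<oplus>\<^bsub>M\<^esub> y) = f x \<oplus>\<^bsub>N\<^esub> f y"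
    and "finite X" "u \<in> X \<rightarrow> carrier M"
  shows "f (\<Oplus>\<^bsub>M\<^esub>x\<in>X. u x) = (\<Oplus>\<^bsub>N\<^esub>x\<in>X. f (u x))"
proof -
  interpret M: abelian_group M by fact
  interpret N: abelian_group N by fact
  show ?thesis using assms(5,6)
  proof (induction X)
    case empty
    then show ?case using additive_zero[OF assms(1-4)] by simp
  next
    case (insert x X)
    then have "(\<Oplus>\<^bsub>M\<^esub>x\<in>insert x X. u x) = u x \<oplus>\<^bsub>M\<^esub> (\<Oplus>\<^bsub>M\<^esub>x\<in>X. u x)"
      by (intro M.finsum_insert) auto
    moreover have "(\<Oplus>\<^bsub>N\<^esub>x\<in>insert x X. f (u x)) = f (u x) \<oplus>\<^bsub>N\<^esub> (\<Oplus>\<^bsub>N\<^esub>x\<in>X. f (u x))"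
      using insert assms(3) by (intro N.finsum_insert) auto
    ultimately show ?case using insert assms(4) by (simp add: Pi_def)
  qed
qed

context group_ring_module
begin

lemma act_closed: "\<lbrakk>h \<in> carrier H; x \<in> carrier M\<rbrakk> \<Longrightarrow> act M h x \<in> carrier M"
  using action.element_image[of h x "act M h x"] by simp

lemma act_finsum:
  assumes "h \<in> carrier H" "finite X" "u \<in> X \<rightarrow> carrier M"
  shows "act M h (\<Oplus>\<^bsub>M\<^esub>x\<in>X. u x) = (\<Oplus>\<^bsub>M\<^esub>x\<in>X. act M h (u x))"
  using assms by (intro additive_finsum M.abelian_group_axioms) (auto simp: act_closed act_add)

end

text \<open>
  Equivariance of every map built from coordinates comes down to this reindexing:
  moving both the vectors and the coefficients by the same permutation amounts to acting
  on the sum.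
\<close>
lemma (in group_ring_module) act_permuted_combination:
  assumes h: "h \<in> carrier H" and X: "finite X" "bij_betw \<sigma> X X"
    and d: "d \<in> X \<rightarrow> carrier R" and e: "e \<in> X \<rightarrow> carrier M"
    and e\<sigma>: "\<And>x. x \<in> X \<Longrightarrow> e (\<sigma> x) = act M h (e x)"
    and d\<sigma>: "\<And>x. x \<in> X \<Longrightarrow> d' (\<sigma> x) = d x"
  shows "(\<Oplus>\<^bsub>M\<^esub>x\<in>X. d' x \<odot>\<^bsub>M\<^esub> e x) = act M h (\<Oplus>\<^bsub>M\<^esub>x\<in>X. d x \<odot>\<^bsub>M\<^esub> e x)"
proof -
  have \<sigma>X: "\<sigma> ` X = X" and inj: "inj_on \<sigma> X" using X(2) by (auto simp: bij_betw_def)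
  have d': "d' x \<in> carrier R" if "x \<in> X" for x
  proof -
    obtain y where "y \<in> X" "x = \<sigma> y" using \<open>x \<in> X\<close> \<sigma>X by blast
    then show ?thesis using d\<sigma> d by auto
  qed
  have "(\<Oplus>\<^bsub>M\<^esub>x\<in>X. d' x \<odot>\<^bsub>M\<^esub> e x) = (\<Oplus>\<^bsub>M\<^esub>x\<in>\<sigma> ` X. d' x \<odot>\<^bsub>M\<^esub> e x)"
    unfolding \<sigma>X ..
  also have "\<dots> = (\<Oplus>\<^bsub>M\<^esub>x\<in>X. d' (\<sigma> x) \<odot>\<^bsub>M\<^esub> e (\<sigma> x))"
    using d' e inj \<sigma>X by (intro M.finsum_reindex) auto
  also have "\<dots> = (\<Oplus>\<^bsub>M\<^esub>x\<in>X. act M h (d x \<odot>\<^bsub>M\<^esub> e x))"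
    using d e h by (intro M.finsum_cong') (auto simp: e\<sigma> d\<sigma> act_smult Pi_def act_closed)
  also have "\<dots> = act M h (\<Oplus>\<^bsub>M\<^esub>x\<in>X. d x \<odot>\<^bsub>M\<^esub> e x)"
    using d e by (intro act_finsum[symmetric] h X(1)) auto
  finally show ?thesis .
qed

lemma (in module) finsum_in_submodule:
  assumes "submodule U R M" "finite X" "u \<in> X \<rightarrow> U"
  shows "(\<Oplus>\<^bsub>M\<^esub>x\<in>X. u x) \<in> U"
  using assms(2,3)
proof (induction X)
  case empty
  then show ?case using assms(1) by (metis M.finsum_empty monoid.select_convs(2) submodule.axioms(1) subgroup.one_closed)
next
  case (insert x X)
  then have "(\<Oplus>\<^bsub>M\<^esub>x\<in>insert x X. u x) = u x \<oplus>\<^bsub>M\<^esub> (\<Oplus>\<^bsub>M\<^esub>x\<in>X. u x)"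
    using submoduleE(1)[OF assms(1)] by (intro M.finsum_insert) auto
  then show ?case using insert submoduleE(5)[OF assms(1)] by auto
qed

section \<open>Representatives of residue classes\<close>

text \<open>
  The predicate below \<open>SOME\<close> depends only on the class of \<open>a\<close> modulo \<open>\<pi>\<close>, so the
  representative does as well.
\<close>
definition residue_rep :: "('r, 'i) ring_scheme \<Rightarrow> 'r \<Rightarrow> 'r \<Rightarrow> 'r"
  where "residue_rep R \<pi> a = (SOME b. \<exists>s \<in> carrier R. b = a \<oplus>\<^bsub>R\<^esub> \<pi> \<otimes>\<^bsub>R\<^esub> s)"

context cring
begin

lemma residue_rep_eq:
  assumes "\<pi> \<in> carrier R" "a \<in> carrier R"
  obtains s where "s \<in> carrier R" "residue_rep R \<pi> a = a \<oplus> \<pi> \<otimes> s"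
proof -
  have "\<exists>s \<in> carrier R. residue_rep R \<pi> a = a \<oplus> \<pi> \<otimes> s"
    unfolding residue_rep_def by (rule someI_ex) auto
  then show thesis using that by blast
qed

lemma residue_rep_closed:
  "\<lbrakk>\<pi> \<in> carrier R; a \<in> carrier R\<rbrakk> \<Longrightarrow> residue_rep R \<pi> a \<in> carrier R"
  by (metis residue_rep_eq a_closed m_closed)

lemma residue_rep_cong:
  assumes \<pi>: "\<pi> \<in> carrier R" and a: "a \<in> carrier R" and t: "t \<in> carrier R"
  shows "residue_rep R \<pi> (a \<oplus> \<pi> \<otimes> t) = residue_rep R \<pi> a"
proof -
  have "(\<exists>s \<in> carrier R. b = a \<oplus> \<pi> \<otimes> t \<oplus> \<pi> \<otimes> s) \<longleftrightarrow> (\<exists>s \<in> carrier R. b = a \<oplus> \<pi> \<otimes> s)" for b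
  proof
    assume "\<exists>s \<in> carrier R. b = a \<oplus> \<pi> \<otimes> t \<oplus> \<pi> \<otimes> s"
    then obtain s where "s \<in> carrier R" "b = a \<oplus> \<pi> \<otimes> t \<oplus> \<pi> \<otimes> s" by blast
    then have "b = a \<oplus> \<pi> \<otimes> (t \<oplus> s)" using \<pi> a t by (simp add: r_distr a_assoc)
    then show "\<exists>s \<in> carrier R. b = a \<oplus> \<pi> \<otimes> s" using t \<open>s \<in> carrier R\<close> by blast
  next
    assume "\<exists>s \<in> carrier R. b = a \<oplus> \<pi> \<otimes> s"
    then obtain s where s: "s \<in> carrier R" "b = a \<oplus> \<pi> \<otimes> s" by blast
    have "t \<oplus> (\<ominus> t \<oplus> s) = s" using s(1) t by (simp add: a_assoc[symmetric] r_neg)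
    then have "b = a \<oplus> \<pi> \<otimes> (t \<oplus> (\<ominus> t \<oplus> s))" using s(2) by simp
    also have "\<dots> = a \<oplus> \<pi> \<otimes> t \<oplus> \<pi> \<otimes> (\<ominus> t \<oplus> s)" using s(1) \<pi> a t by (simp add: r_distr a_ac)
    finally show "\<exists>s \<in> carrier R. b = a \<oplus> \<pi> \<otimes> t \<oplus> \<pi> \<otimes> s" using s(1) t by blast
  qed
  then show ?thesis by (simp add: residue_rep_def)
qed

end

section \<open>Summands of permutation modules\<close>

text \<open>
  What a direct summand \<open>M\<close> of a permutation module with permuted basis \<open>X\<close> retains: the
  projections \<open>e x\<close> of the basis vectors, and the coordinates \<open>c n x\<close> of its elements in the
  ambient module. Distinct basis vectors may have the same projection, so \<open>X\<close> is an index set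
  with its own action \<open>\<alpha>\<close> and not a subset of \<open>M\<close>.
\<close>
locale permutation_frame = group_ring_module R H M
  for R :: "('r, 'i) ring_scheme" (structure)
    and H :: "('h, 'j) monoid_scheme" (structure)
    and M :: "('r, 'm, 'h, 'k) gmodule_scheme" (structure) +
  fixes X :: "'x set" and \<alpha> :: "'h \<Rightarrow> 'x \<Rightarrow> 'x" and e :: "'x \<Rightarrow> 'm" and c :: "'m \<Rightarrow> 'x \<Rightarrow> 'r"
  assumes finite_X: "finite X"
    and \<alpha>_bij: "h \<in> carrier H \<Longrightarrow> bij_betw (\<alpha> h) X X"
    and e_closed: "x \<in> X \<Longrightarrow> e x \<in> carrier M"
    and e_act: "\<lbrakk>h \<in> carrier H; x \<in> X\<rbrakk> \<Longrightarrow> e (\<alpha> h x) = act M h (e x)"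
    and c_closed: "\<lbrakk>n \<in> carrier M; x \<in> X\<rbrakk> \<Longrightarrow> c n x \<in> carrier R"
    and c_add: "\<lbrakk>n \<in> carrier M; n' \<in> carrier M; x \<in> X\<rbrakk> \<Longrightarrow> c (n \<oplus>\<^bsub>M\<^esub> n') x = c n x \<oplus>\<^bsub>R\<^esub> c n' x"
    and c_smult: "\<lbrakk>r \<in> carrier R; n \<in> carrier M; x \<in> X\<rbrakk> \<Longrightarrow> c (r \<odot>\<^bsub>M\<^esub> n) x = r \<otimes>\<^bsub>R\<^esub> c n x"
    and c_act: "\<lbrakk>h \<in> carrier H; n \<in> carrier M; x \<in> X\<rbrakk> \<Longrightarrow> c (act M h n) (\<alpha> h x) = c n x"
    and expansion: "n \<in> carrier M \<Longrightarrow> n = (\<Oplus>\<^bsub>M\<^esub>x\<in>X. c n x \<odot>\<^bsub>M\<^esub> e x)"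
begin

lemma eq_zero_if_coefficients_zero:
  assumes "n \<in> carrier M" "\<And>x. x \<in> X \<Longrightarrow> c n x = \<zero>\<^bsub>R\<^esub>"
  shows "n = \<zero>\<^bsub>M\<^esub>"
proof -
  have "n = (\<Oplus>\<^bsub>M\<^esub>x\<in>X. c n x \<odot>\<^bsub>M\<^esub> e x)" using assms(1) by (rule expansion)
  also have "\<dots> = (\<Oplus>\<^bsub>M\<^esub>x\<in>X. \<zero>\<^bsub>M\<^esub>)"
    using assms(2) e_closed by (intro M.finsum_cong') auto
  finally show ?thesis by simp
qed

lemma spanning:
  assumes U: "submodule U R M" "e ` X \<subseteq> U"
  shows "U = carrier M"
proof
  show "U \<subseteq> carrier M" using submoduleE(1)[OF U(1)] .
  show "carrier M \<subseteq> U"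
  proof
    fix n assume n: "n \<in> carrier M"
    have "(\<Oplus>\<^bsub>M\<^esub>x\<in>X. c n x \<odot>\<^bsub>M\<^esub> e x) \<in> U"
      using n U submoduleE(4)[OF U(1)] c_closed by (intro finsum_in_submodule finite_X) auto
    then show "n \<in> U" using expansion[OF n] by simp
  qed
qed

text \<open>
  Coordinates are linear and vanish together only at zero, so regularity of \<open>\<pi>\<close> passes from
  \<open>R\<close> to \<open>M\<close>; the same argument applies to separatedness below.
\<close>
lemma torsion_free:
  assumes \<pi>: "\<pi> \<in> carrier R" and reg: "\<And>a. \<lbrakk>a \<in> carrier R; \<pi> \<otimes>\<^bsub>R\<^esub> a = \<zero>\<^bsub>R\<^esub>\<rbrakk> \<Longrightarrow> a = \<zero>\<^bsub>R\<^esub>"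
    and n: "n \<in> carrier M" "\<pi> \<odot>\<^bsub>M\<^esub> n = \<zero>\<^bsub>M\<^esub>"
  shows "n = \<zero>\<^bsub>M\<^esub>"
proof (rule eq_zero_if_coefficients_zero[OF n(1)])
  fix x assume x: "x \<in> X"
  have "\<pi> \<otimes>\<^bsub>R\<^esub> c n x = c (\<zero>\<^bsub>R\<^esub> \<odot>\<^bsub>M\<^esub> n) x" using c_smult[OF \<pi> n(1) x] n by simp
  also have "\<dots> = \<zero>\<^bsub>R\<^esub>" using c_smult[OF R.zero_closed n(1) x] c_closed[OF n(1) x] by simp
  finally show "c n x = \<zero>\<^bsub>R\<^esub>" using reg c_closed n(1) x by blast
qed

lemma separated:
  assumes \<pi>: "\<pi> \<in> carrier R"
    and sep: "\<And>a. \<lbrakk>a \<in> carrier R; \<forall>k::nat. \<exists>b \<in> carrier R. a = \<pi> [^]\<^bsub>R\<^esub> k \<otimes>\<^bsub>R\<^esub> b\<rbrakk> \<Longrightarrow> a = \<zero>\<^bsub>R\<^esub>"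
    and n: "n \<in> carrier M" "\<And>k::nat. \<exists>m \<in> carrier M. n = \<pi> [^]\<^bsub>R\<^esub> k \<odot>\<^bsub>M\<^esub> m"
  shows "n = \<zero>\<^bsub>M\<^esub>"
proof (rule eq_zero_if_coefficients_zero[OF n(1)])
  fix x assume x: "x \<in> X"
  have "\<exists>b \<in> carrier R. c n x = \<pi> [^]\<^bsub>R\<^esub> k \<otimes>\<^bsub>R\<^esub> b" for k :: nat
  proof -
    obtain m where m: "m \<in> carrier M" "n = \<pi> [^]\<^bsub>R\<^esub> k \<odot>\<^bsub>M\<^esub> m" using n(2) by blast
    then have "c n x = \<pi> [^]\<^bsub>R\<^esub> k \<otimes>\<^bsub>R\<^esub> c m x" using c_smult \<pi> x by simp
    then show ?thesis using c_closed m(1) x by blast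
  qed
  then show "c n x = \<zero>\<^bsub>R\<^esub>" using sep c_closed n(1) x by blast
qed

text \<open>
  A section of the projection from \<open>M\<close> to \<open>M / \<pi> M\<close>, composed with that projection. It is only
  a map of sets, but that is enough to choose lifts of basis vectors, and it commutes
  with \<open>H\<close>.
\<close>
definition residue_section :: "'r \<Rightarrow> 'm \<Rightarrow> 'm"
  where "residue_section \<pi> n = (\<Oplus>\<^bsub>M\<^esub>x\<in>X. residue_rep R \<pi> (c n x) \<odot>\<^bsub>M\<^esub> e x)"

lemma residue_section_closed:
  "\<lbrakk>\<pi> \<in> carrier R; n \<in> carrier M\<rbrakk> \<Longrightarrow> residue_section \<pi> n \<in> carrier M"
  unfolding residue_section_def
  by (intro M.finsum_closed) (auto simp: R.residue_rep_closed c_closed e_closed)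

lemma residue_section_eq:
  assumes \<pi>: "\<pi> \<in> carrier R" and n: "n \<in> carrier M"
  obtains m where "m \<in> carrier M" "residue_section \<pi> n = n \<oplus>\<^bsub>M\<^esub> \<pi> \<odot>\<^bsub>M\<^esub> m"
proof -
  have "\<forall>x\<in>X. \<exists>s. s \<in> carrier R \<and> residue_rep R \<pi> (c n x) = c n x \<oplus>\<^bsub>R\<^esub> \<pi> \<otimes>\<^bsub>R\<^esub> s"
    using R.residue_rep_eq \<pi> c_closed n by metis
  then obtain s where s: "\<And>x. x \<in> X \<Longrightarrow> s x \<in> carrier R"
    "\<And>x. x \<in> X \<Longrightarrow> residue_rep R \<pi> (c n x) = c n x \<oplus>\<^bsub>R\<^esub> \<pi> \<otimes>\<^bsub>R\<^esub> s x" by metis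
  let ?m = "\<Oplus>\<^bsub>M\<^esub>x\<in>X. s x \<odot>\<^bsub>M\<^esub> e x"
  have "residue_section \<pi> n = (\<Oplus>\<^bsub>M\<^esub>x\<in>X. c n x \<odot>\<^bsub>M\<^esub> e x \<oplus>\<^bsub>M\<^esub> \<pi> \<odot>\<^bsub>M\<^esub> (s x \<odot>\<^bsub>M\<^esub> e x))"
    unfolding residue_section_def using s n \<pi> c_closed e_closed
    by (intro M.finsum_cong') (auto simp: smult_l_distr smult_assoc1)
  also have "\<dots> = (\<Oplus>\<^bsub>M\<^esub>x\<in>X. c n x \<odot>\<^bsub>M\<^esub> e x) \<oplus>\<^bsub>M\<^esub> (\<Oplus>\<^bsub>M\<^esub>x\<in>X. \<pi> \<odot>\<^bsub>M\<^esub> (s x \<odot>\<^bsub>M\<^esub> e x))"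
    using s n \<pi> c_closed e_closed by (intro M.finsum_addf) auto
  also have "(\<Oplus>\<^bsub>M\<^esub>x\<in>X. \<pi> \<odot>\<^bsub>M\<^esub> (s x \<odot>\<^bsub>M\<^esub> e x)) = \<pi> \<odot>\<^bsub>M\<^esub> ?m"
    using s \<pi> e_closed by (intro finsum_smult_ldistr[symmetric] finite_X) auto
  also have "(\<Oplus>\<^bsub>M\<^esub>x\<in>X. c n x \<odot>\<^bsub>M\<^esub> e x) = n" using expansion[OF n] by simp
  finally show thesis using that[of ?m] s e_closed by (simp add: M.finsum_closed Pi_def)
qed

lemma residue_section_cong:
  assumes \<pi>: "\<pi> \<in> carrier R" and n: "n \<in> carrier M" and m: "m \<in> carrier M"
  shows "residue_section \<pi> (n \<oplus>\<^bsub>M\<^esub> \<pi> \<odot>\<^bsub>M\<^esub> m) = residue_section \<pi> n"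
  unfolding residue_section_def using assms
  by (intro M.finsum_cong')
    (auto simp: c_add c_smult R.residue_rep_cong R.residue_rep_closed c_closed e_closed)

text \<open>
  The group permutes coordinates, and the same function \<open>residue_rep R \<pi>\<close> is applied to each
  of them; these two operations commute.
\<close>
lemma residue_section_act:
  assumes \<pi>: "\<pi> \<in> carrier R" and h: "h \<in> carrier H" and n: "n \<in> carrier M"
  shows "residue_section \<pi> (act M h n) = act M h (residue_section \<pi> n)"
  unfolding residue_section_def using assms
  by (intro act_permuted_combination[OF h finite_X \<alpha>_bij[OF h]])
    (auto simp: c_act e_act R.residue_rep_closed c_closed e_closed)

end

section \<open>Lifting isomorphisms modulo an element of the Jacobson radical\<close>

text \<open>
  An isomorphism from \<open>M / \<pi> M\<close> to \<open>N / \<pi> N\<close>, given by its graph pulled back to \<open>M\<close> and \<open>N\<close>: the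
  relation \<open>\<rho> x y\<close> says that the class of \<open>x\<close> is sent to the class of \<open>y\<close>. In this form no
  particular construction of the quotients is involved.
\<close>
locale residue_correspondence =
  M: permutation_frame R H M X \<alpha> e c + N: permutation_frame R H N Y \<beta> e' c'
  for R :: "('r, 'i) ring_scheme" (structure)
    and H :: "('h, 'j) monoid_scheme" (structure)
    and M :: "('r, 'm, 'h, 'k) gmodule_scheme" and X :: "'x set" and \<alpha> e c
    and N :: "('r, 'n, 'h, 'l) gmodule_scheme" and Y :: "'y set" and \<beta> e' c' +
  fixes \<pi> :: 'r and \<rho> :: "'m \<Rightarrow> 'n \<Rightarrow> bool"
  assumes \<pi>_closed: "\<pi> \<in> carrier R"
    and \<rho>_left_total: "x \<in> carrier M \<Longrightarrow> \<exists>y \<in> carrier N. \<rho> x y"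
    and \<rho>_right_total: "y \<in> carrier N \<Longrightarrow> \<exists>x \<in> carrier M. \<rho> x y"
    and \<rho>_add: "\<lbrakk>x \<in> carrier M; y \<in> carrier N; x' \<in> carrier M; y' \<in> carrier N; \<rho> x y; \<rho> x' y'\<rbrakk>
      \<Longrightarrow> \<rho> (x \<oplus>\<^bsub>M\<^esub> x') (y \<oplus>\<^bsub>N\<^esub> y')"
    and \<rho>_smult: "\<lbrakk>r \<in> carrier R; x \<in> carrier M; y \<in> carrier N; \<rho> x y\<rbrakk> \<Longrightarrow> \<rho> (r \<odot>\<^bsub>M\<^esub> x) (r \<odot>\<^bsub>N\<^esub> y)"
    and \<rho>_act: "\<lbrakk>h \<in> carrier H; x \<in> carrier M; y \<in> carrier N; \<rho> x y\<rbrakk> \<Longrightarrow> \<rho> (act M h x) (act N h y)"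
    and \<rho>_left_kernel: "x \<in> carrier M \<Longrightarrow> \<rho> x \<zero>\<^bsub>N\<^esub> \<longleftrightarrow> (\<exists>z \<in> carrier M. x = \<pi> \<odot>\<^bsub>M\<^esub> z)"
    and \<rho>_right_kernel: "y \<in> carrier N \<Longrightarrow> \<rho> \<zero>\<^bsub>M\<^esub> y \<longleftrightarrow> (\<exists>z \<in> carrier N. y = \<pi> \<odot>\<^bsub>N\<^esub> z)"
begin

lemma \<rho>_unique:
  assumes x: "x \<in> carrier M" and y: "y \<in> carrier N" "\<rho> x y" and y': "y' \<in> carrier N" "\<rho> x y'"
  obtains z where "z \<in> carrier N" "y' = y \<oplus>\<^bsub>N\<^esub> \<pi> \<odot>\<^bsub>N\<^esub> z"
proof -
  have m1: "\<ominus>\<^bsub>R\<^esub> \<one>\<^bsub>R\<^esub> \<in> carrier R" by simp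
  have "\<rho> ((\<ominus>\<^bsub>R\<^esub> \<one>\<^bsub>R\<^esub>) \<odot>\<^bsub>M\<^esub> x \<oplus>\<^bsub>M\<^esub> x) ((\<ominus>\<^bsub>R\<^esub> \<one>\<^bsub>R\<^esub>) \<odot>\<^bsub>N\<^esub> y \<oplus>\<^bsub>N\<^esub> y')"
    using m1 x y y' by (intro \<rho>_add \<rho>_smult M.smult_closed N.smult_closed) auto
  then have "\<rho> \<zero>\<^bsub>M\<^esub> (\<ominus>\<^bsub>N\<^esub> y \<oplus>\<^bsub>N\<^esub> y')"
    using x y y' by (simp add: M.smult_l_minus N.smult_l_minus M.M.l_neg)
  then obtain z where z: "z \<in> carrier N" "\<ominus>\<^bsub>N\<^esub> y \<oplus>\<^bsub>N\<^esub> y' = \<pi> \<odot>\<^bsub>N\<^esub> z"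
    using \<rho>_right_kernel y y' by auto
  then have "y \<oplus>\<^bsub>N\<^esub> \<pi> \<odot>\<^bsub>N\<^esub> z = y \<oplus>\<^bsub>N\<^esub> (\<ominus>\<^bsub>N\<^esub> y \<oplus>\<^bsub>N\<^esub> y')" by simp
  also have "\<dots> = y'" using y y' by (simp add: N.M.a_assoc[symmetric] N.M.r_neg)
  finally show thesis using that z by simp
qed

lemma \<rho>_zero: "\<rho> \<zero>\<^bsub>M\<^esub> \<zero>\<^bsub>N\<^esub>"
proof -
  have "\<zero>\<^bsub>N\<^esub> = \<pi> \<odot>\<^bsub>N\<^esub> \<zero>\<^bsub>N\<^esub>" using \<pi>_closed by simp
  then show ?thesis using \<rho>_right_kernel by blast
qed

lemma \<rho>_combination:
  assumes "finite Z" "d \<in> Z \<rightarrow> carrier R" "u \<in> Z \<rightarrow> carrier M" "v \<in> Z \<rightarrow> carrier N"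
    "\<And>z. z \<in> Z \<Longrightarrow> \<rho> (u z) (v z)"
  shows "\<rho> (\<Oplus>\<^bsub>M\<^esub>z\<in>Z. d z \<odot>\<^bsub>M\<^esub> u z) (\<Oplus>\<^bsub>N\<^esub>z\<in>Z. d z \<odot>\<^bsub>N\<^esub> v z)"
  using assms
proof (induction Z)
  case empty
  then show ?case using \<rho>_zero by simp
next
  case (insert z Z)
  have "(\<Oplus>\<^bsub>M\<^esub>z\<in>insert z Z. d z \<odot>\<^bsub>M\<^esub> u z) = d z \<odot>\<^bsub>M\<^esub> u z \<oplus>\<^bsub>M\<^esub> (\<Oplus>\<^bsub>M\<^esub>z\<in>Z. d z \<odot>\<^bsub>M\<^esub> u z)"
    using insert by (intro M.M.finsum_insert) auto
  moreover have "(\<Oplus>\<^bsub>N\<^esub>z\<in>insert z Z. d z \<odot>\<^bsub>N\<^esub> v z) = d z \<odot>\<^bsub>N\<^esub> v z \<oplus>\<^bsub>N\<^esub> (\<Oplus>\<^bsub>N\<^esub>z\<in>Z. d z \<odot>\<^bsub>N\<^esub> v z)"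
    using insert by (intro N.M.finsum_insert) auto
  moreover have "(\<Oplus>\<^bsub>M\<^esub>z\<in>Z. d z \<odot>\<^bsub>M\<^esub> u z) \<in> carrier M" "(\<Oplus>\<^bsub>N\<^esub>z\<in>Z. d z \<odot>\<^bsub>N\<^esub> v z) \<in> carrier N"
    using insert.prems by (auto intro!: M.M.finsum_closed N.M.finsum_closed)
  ultimately show ?case using insert by (simp add: \<rho>_add \<rho>_smult Pi_def)
qed

text \<open>
  The values \<open>v x\<close> of the lift at the vectors \<open>e x\<close> have to satisfy \<open>v (\<alpha> h x) = h (v x)\<close> on
  the nose. Arbitrary elements of \<open>N\<close> related to \<open>e x\<close> satisfy it only modulo \<open>\<pi>\<close>; the section
  of \<open>N\<close> removes the ambiguity, because it is equivariant and constant on classes.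
\<close>
lemma equivariant_lift:
  "\<exists>f \<in> equivariant_maps R H M N. \<forall>x \<in> carrier M. \<rho> x (f x)"
proof -
  define v where "v x = N.residue_section \<pi> (SOME y. y \<in> carrier N \<and> \<rho> (e x) y)" for x
  define f where "f n = (\<Oplus>\<^bsub>N\<^esub>x\<in>X. c n x \<odot>\<^bsub>N\<^esub> v x)" for n
  have some: "(SOME y. y \<in> carrier N \<and> \<rho> (e x) y) \<in> carrier N"
    "\<rho> (e x) (SOME y. y \<in> carrier N \<and> \<rho> (e x) y)" if "x \<in> X" for x
    using someI_ex[of "\<lambda>y. y \<in> carrier N \<and> \<rho> (e x) y"] \<rho>_left_total M.e_closed that by blast+
  have v_eq: "v x = N.residue_section \<pi> y" if x: "x \<in> X" and y: "y \<in> carrier N" "\<rho> (e x) y" for x y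
  proof -
    obtain z where "z \<in> carrier N" "(SOME y. y \<in> carrier N \<and> \<rho> (e x) y) = y \<oplus>\<^bsub>N\<^esub> \<pi> \<odot>\<^bsub>N\<^esub> z"
      using \<rho>_unique[OF M.e_closed[OF x] y some[OF x]] .
    then show ?thesis unfolding v_def using N.residue_section_cong \<pi>_closed y(1) by simp
  qed
  have v_closed: "v x \<in> carrier N" if "x \<in> X" for x
    unfolding v_def by (rule N.residue_section_closed[OF \<pi>_closed some(1)[OF that]])
  have v_act: "v (\<alpha> h x) = act N h (v x)" if h: "h \<in> carrier H" and x: "x \<in> X" for h x
  proof -
    let ?y = "SOME y. y \<in> carrier N \<and> \<rho> (e x) y"
    have "\<rho> (e (\<alpha> h x)) (act N h ?y)"
      using M.e_act[OF h x] \<rho>_act[OF h M.e_closed[OF x] some[OF x]] by simp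
    moreover have "\<alpha> h x \<in> X" using M.\<alpha>_bij[OF h] x by (auto simp: bij_betw_def)
    ultimately have "v (\<alpha> h x) = N.residue_section \<pi> (act N h ?y)"
      using v_eq N.act_closed[OF h some(1)[OF x]] by blast
    then show ?thesis using N.residue_section_act[OF \<pi>_closed h some(1)[OF x]] by (simp add: v_def)
  qed
  have \<rho>v: "\<rho> (e x) (v x)" if x: "x \<in> X" for x
  proof -
    let ?y = "SOME y. y \<in> carrier N \<and> \<rho> (e x) y"
    obtain z where z: "z \<in> carrier N" "v x = ?y \<oplus>\<^bsub>N\<^esub> \<pi> \<odot>\<^bsub>N\<^esub> z"
      using N.residue_section_eq[OF \<pi>_closed some(1)[OF x]] unfolding v_def by blast
    have "\<rho> \<zero>\<^bsub>M\<^esub> (\<pi> \<odot>\<^bsub>N\<^esub> z)" using \<rho>_right_kernel z(1) \<pi>_closed by blast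
    then have "\<rho> (e x \<oplus>\<^bsub>M\<^esub> \<zero>\<^bsub>M\<^esub>) (?y \<oplus>\<^bsub>N\<^esub> \<pi> \<odot>\<^bsub>N\<^esub> z)"
      using z(1) \<pi>_closed some[OF x] M.e_closed[OF x] by (intro \<rho>_add) auto
    then show ?thesis using z(2) M.e_closed[OF x] by simp
  qed
  have f_closed: "f n \<in> carrier N" if "n \<in> carrier M" for n
    unfolding f_def using that v_closed M.c_closed by (intro N.M.finsum_closed) auto
  have "f \<in> equivariant_maps R H M N"
    unfolding equivariant_maps_def
  proof (intro CollectI conjI ballI)
    show "f \<in> carrier M \<rightarrow> carrier N" using f_closed by simp
  next
    fix n n' assume n: "n \<in> carrier M" "n' \<in> carrier M"
    have "f (n \<oplus>\<^bsub>M\<^esub> n') = (\<Oplus>\<^bsub>N\<^esub>x\<in>X. c n x \<odot>\<^bsub>N\<^esub> v x \<oplus>\<^bsub>N\<^esub> c n' x \<odot>\<^bsub>N\<^esub> v x)"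
      unfolding f_def using n v_closed M.c_closed
      by (intro N.M.finsum_cong') (auto simp: M.c_add N.smult_l_distr)
    also have "\<dots> = f n \<oplus>\<^bsub>N\<^esub> f n'"
      unfolding f_def using n v_closed M.c_closed by (intro N.M.finsum_addf) auto
    finally show "f (n \<oplus>\<^bsub>M\<^esub> n') = f n \<oplus>\<^bsub>N\<^esub> f n'" .
  next
    fix r n assume n: "r \<in> carrier R" "n \<in> carrier M"
    have "f (r \<odot>\<^bsub>M\<^esub> n) = (\<Oplus>\<^bsub>N\<^esub>x\<in>X. r \<odot>\<^bsub>N\<^esub> (c n x \<odot>\<^bsub>N\<^esub> v x))"
      unfolding f_def using n v_closed M.c_closed
      by (intro N.M.finsum_cong') (auto simp: M.c_smult N.smult_assoc1)
    also have "\<dots> = r \<odot>\<^bsub>N\<^esub> f n"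
      unfolding f_def using n v_closed M.c_closed
      by (intro N.finsum_smult_ldistr[symmetric] M.finite_X) auto
    finally show "f (r \<odot>\<^bsub>M\<^esub> n) = r \<odot>\<^bsub>N\<^esub> f n" .
  next
    fix h n assume h: "h \<in> carrier H" and n: "n \<in> carrier M"
    show "f (act M h n) = act N h (f n)"
      unfolding f_def using n v_closed M.c_closed M.c_act h v_act
      by (intro N.act_permuted_combination[OF h M.finite_X M.\<alpha>_bij[OF h]]) auto
  qed
  moreover have "\<rho> n (f n)" if n: "n \<in> carrier M" for n
  proof -
    have "\<rho> (\<Oplus>\<^bsub>M\<^esub>x\<in>X. c n x \<odot>\<^bsub>M\<^esub> e x) (f n)"
      unfolding f_def using n v_closed M.c_closed M.e_closed \<rho>v
      by (intro \<rho>_combination M.finite_X) auto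
    then show ?thesis using M.expansion[OF n] by simp
  qed
  ultimately show ?thesis by blast
qed

text \<open>
  An element of the kernel is related to zero, hence of the form \<open>\<pi> m\<close>, and \<open>m\<close> is again in
  the kernel because \<open>N\<close> has no \<open>\<pi>\<close>-torsion. Iterating, it is divisible by all powers of \<open>\<pi>\<close>.
\<close>
lemma lift_injective:
  assumes reg: "\<And>a. \<lbrakk>a \<in> carrier R; \<pi> \<otimes>\<^bsub>R\<^esub> a = \<zero>\<^bsub>R\<^esub>\<rbrakk> \<Longrightarrow> a = \<zero>\<^bsub>R\<^esub>"
    and sep: "\<And>a. \<lbrakk>a \<in> carrier R; \<forall>k::nat. \<exists>b \<in> carrier R. a = \<pi> [^]\<^bsub>R\<^esub> k \<otimes>\<^bsub>R\<^esub> b\<rbrakk> \<Longrightarrow> a = \<zero>\<^bsub>R\<^esub>"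
    and f: "f \<in> equivariant_maps R H M N" and \<rho>f: "\<And>x. x \<in> carrier M \<Longrightarrow> \<rho> x (f x)"
  shows "inj_on f (carrier M)"
proof -
  have kernel: "x = \<zero>\<^bsub>M\<^esub>" if x: "x \<in> carrier M" "f x = \<zero>\<^bsub>N\<^esub>" for x
  proof (rule M.separated[OF \<pi>_closed sep x(1)])
    fix k :: nat
    have "\<exists>m \<in> carrier M. x = \<pi> [^]\<^bsub>R\<^esub> k \<odot>\<^bsub>M\<^esub> m \<and> f m = \<zero>\<^bsub>N\<^esub>"
    proof (induction k)
      case 0
      then show ?case using x by auto
    next
      case (Suc k)
      then obtain m where m: "m \<in> carrier M" "x = \<pi> [^]\<^bsub>R\<^esub> k \<odot>\<^bsub>M\<^esub> m" "f m = \<zero>\<^bsub>N\<^esub>" by blast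
      then obtain m' where m': "m' \<in> carrier M" "m = \<pi> \<odot>\<^bsub>M\<^esub> m'"
        using \<rho>f[OF m(1)] \<rho>_left_kernel by auto
      have "\<pi> \<odot>\<^bsub>N\<^esub> f m' = \<zero>\<^bsub>N\<^esub>" using equivariant_maps_smult[OF f \<pi>_closed m'(1)] m m' by simp
      then have "f m' = \<zero>\<^bsub>N\<^esub>"
        using N.torsion_free[OF \<pi>_closed reg equivariant_maps_closed[OF f m'(1)]] by blast
      moreover have "x = \<pi> [^]\<^bsub>R\<^esub> Suc k \<odot>\<^bsub>M\<^esub> m'"
        using m m' \<pi>_closed by (simp add: M.smult_assoc1)
      ultimately show ?case using m'(1) by blast
    qed
    then show "\<exists>m \<in> carrier M. x = \<pi> [^]\<^bsub>R\<^esub> k \<odot>\<^bsub>M\<^esub> m" by blast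
  qed
  show ?thesis
  proof (rule inj_onI)
    fix x y assume x: "x \<in> carrier M" and y: "y \<in> carrier M" and eq: "f x = f y"
    have fz: "f \<zero>\<^bsub>M\<^esub> = \<zero>\<^bsub>N\<^esub>"
      using f by (intro additive_zero[OF M.M.abelian_group_axioms N.M.abelian_group_axioms])
        (auto simp: equivariant_maps_def)
    have "f (\<ominus>\<^bsub>M\<^esub> y \<oplus>\<^bsub>M\<^esub> x) = f (\<ominus>\<^bsub>M\<^esub> y) \<oplus>\<^bsub>N\<^esub> f y"
      using equivariant_maps_add[OF f] x y eq by simp
    also have "\<dots> = f (\<ominus>\<^bsub>M\<^esub> y \<oplus>\<^bsub>M\<^esub> y)" using equivariant_maps_add[OF f] y by simp
    also have "\<dots> = \<zero>\<^bsub>N\<^esub>" using y fz by (simp add: M.M.l_neg)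
    finally have "\<ominus>\<^bsub>M\<^esub> y \<oplus>\<^bsub>M\<^esub> x = \<zero>\<^bsub>M\<^esub>" using kernel x y by simp
    then have "y \<oplus>\<^bsub>M\<^esub> (\<ominus>\<^bsub>M\<^esub> y \<oplus>\<^bsub>M\<^esub> x) = y" using y by simp
    then show "x = y" using x y by (simp add: M.M.a_assoc[symmetric] M.M.r_neg)
  qed
qed

text \<open>
  The image of \<open>f\<close> meets every class modulo \<open>\<pi>\<close>, and \<open>N\<close> is finitely generated, so Nakayama's
  lemma applies.
\<close>
lemma lift_surjective:
  assumes unit: "\<And>a. a \<in> carrier R \<Longrightarrow> \<one>\<^bsub>R\<^esub> \<ominus>\<^bsub>R\<^esub> \<pi> \<otimes>\<^bsub>R\<^esub> a \<in> Units R"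
    and f: "f \<in> equivariant_maps R H M N" and \<rho>f: "\<And>x. x \<in> carrier M \<Longrightarrow> \<rho> x (f x)"
  shows "f ` carrier M = carrier N"
proof (rule N.nakayama[OF \<pi>_closed unit finite_imageI[OF N.finite_X]])
  note fc = equivariant_maps_closed[OF f]
  show "e' ` Y \<subseteq> carrier N" using N.e_closed by blast
  show "U = carrier N" if "submodule U R N" "f ` carrier M \<union> e' ` Y \<subseteq> U" for U
    using N.spanning that by blast
  show "submodule (f ` carrier M) R N"
  proof (rule N.submoduleI)
    show "f ` carrier M \<subseteq> carrier N" using fc by blast
    have "\<zero>\<^bsub>N\<^esub> = f (\<zero>\<^bsub>R\<^esub> \<odot>\<^bsub>M\<^esub> \<zero>\<^bsub>M\<^esub>)"
      using equivariant_maps_smult[OF f M.R.zero_closed M.M.zero_closed] fc[OF M.M.zero_closed] by simp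
    then show "\<zero>\<^bsub>N\<^esub> \<in> f ` carrier M" by blast
  next
    fix a assume "a \<in> f ` carrier M"
    then obtain x where x: "x \<in> carrier M" "a = f x" by blast
    then have "\<ominus>\<^bsub>N\<^esub> a = f ((\<ominus>\<^bsub>R\<^esub> \<one>\<^bsub>R\<^esub>) \<odot>\<^bsub>M\<^esub> x)"
      using equivariant_maps_smult[OF f _ x(1), of "\<ominus>\<^bsub>R\<^esub> \<one>\<^bsub>R\<^esub>"] fc[OF x(1)]
      by (simp add: N.smult_l_minus)
    then show "\<ominus>\<^bsub>N\<^esub> a \<in> f ` carrier M" using x by simp
  next
    fix a b assume "a \<in> f ` carrier M" "b \<in> f ` carrier M"
    then obtain x y where "x \<in> carrier M" "a = f x" "y \<in> carrier M" "b = f y" by blast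
    then have "a \<oplus>\<^bsub>N\<^esub> b = f (x \<oplus>\<^bsub>M\<^esub> y)" "x \<oplus>\<^bsub>M\<^esub> y \<in> carrier M"
      using equivariant_maps_add[OF f] by auto
    then show "a \<oplus>\<^bsub>N\<^esub> b \<in> f ` carrier M" by blast
  next
    fix r a assume "r \<in> carrier R" "a \<in> f ` carrier M"
    then obtain x where "x \<in> carrier M" "a = f x" by blast
    then have "r \<odot>\<^bsub>N\<^esub> a = f (r \<odot>\<^bsub>M\<^esub> x)" "r \<odot>\<^bsub>M\<^esub> x \<in> carrier M"
      using equivariant_maps_smult[OF f] \<open>r \<in> carrier R\<close> by auto
    then show "r \<odot>\<^bsub>N\<^esub> a \<in> f ` carrier M" by blast
  qed
  show "\<exists>s\<in>f ` carrier M. \<exists>z\<in>carrier N. y = s \<oplus>\<^bsub>N\<^esub> \<pi> \<odot>\<^bsub>N\<^esub> z" if y: "y \<in> carrier N" for y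
  proof -
    obtain x where x: "x \<in> carrier M" "\<rho> x y" using \<rho>_right_total y by blast
    obtain z where "z \<in> carrier N" "y = f x \<oplus>\<^bsub>N\<^esub> \<pi> \<odot>\<^bsub>N\<^esub> z"
      using \<rho>_unique[OF x(1) fc[OF x(1)] \<rho>f[OF x(1)] y x(2)] .
    then show ?thesis using x(1) by blast
  qed
qed

theorem residue_correspondence_lifts:
  assumes "\<And>a. \<lbrakk>a \<in> carrier R; \<pi> \<otimes>\<^bsub>R\<^esub> a = \<zero>\<^bsub>R\<^esub>\<rbrakk> \<Longrightarrow> a = \<zero>\<^bsub>R\<^esub>"
    and "\<And>a. \<lbrakk>a \<in> carrier R; \<forall>k::nat. \<exists>b \<in> carrier R. a = \<pi> [^]\<^bsub>R\<^esub> k \<otimes>\<^bsub>R\<^esub> b\<rbrakk> \<Longrightarrow> a = \<zero>\<^bsub>R\<^esub>"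
    and "\<And>a. a \<in> carrier R \<Longrightarrow> \<one>\<^bsub>R\<^esub> \<ominus>\<^bsub>R\<^esub> \<pi> \<otimes>\<^bsub>R\<^esub> a \<in> Units R"
  shows "gmodule_isomorphic R H M N"
proof -
  obtain f where f: "f \<in> equivariant_maps R H M N" "\<And>x. x \<in> carrier M \<Longrightarrow> \<rho> x (f x)"
    using equivariant_lift by blast
  have "bij_betw f (carrier M) (carrier N)"
    unfolding bij_betw_def using lift_injective[OF assms(1,2) f] lift_surjective[OF assms(3) f] by blast
  then show ?thesis unfolding gmodule_isomorphic_iff using f(1) by blast
qed

end

section \<open>Frames of invertible modules\<close>

definition basis_coordinates ::
    "('r, 'i) ring_scheme \<Rightarrow> ('r, 'm, 'k) module_scheme \<Rightarrow> 'm set \<Rightarrow> 'm \<Rightarrow> 'm \<Rightarrow> 'r"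
  where "basis_coordinates R M B v =
    (THE c. c \<in> B \<rightarrow>\<^sub>E carrier R \<and> v = (\<Oplus>\<^bsub>M\<^esub>b\<in>B. c b \<odot>\<^bsub>M\<^esub> b))"

context module
begin

lemma basis_coordinates:
  assumes B: "finite_basis R M B" and v: "v \<in> carrier M"
  shows basis_coordinates_closed: "b \<in> B \<Longrightarrow> basis_coordinates R M B v b \<in> carrier R"
    and basis_coordinates_expansion: "(\<Oplus>\<^bsub>M\<^esub>b\<in>B. basis_coordinates R M B v b \<odot>\<^bsub>M\<^esub> b) = v"
proof -
  have "\<exists>!c. c \<in> B \<rightarrow>\<^sub>E carrier R \<and> v = (\<Oplus>\<^bsub>M\<^esub>b\<in>B. c b \<odot>\<^bsub>M\<^esub> b)"
    using B v unfolding finite_basis_def by blast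
  from theI'[OF this]
  have *: "basis_coordinates R M B v \<in> B \<rightarrow>\<^sub>E carrier R"
    "v = (\<Oplus>\<^bsub>M\<^esub>b\<in>B. basis_coordinates R M B v b \<odot>\<^bsub>M\<^esub> b)"
    unfolding basis_coordinates_def by blast+
  show "b \<in> B \<Longrightarrow> basis_coordinates R M B v b \<in> carrier R" using *(1) by auto
  show "(\<Oplus>\<^bsub>M\<^esub>b\<in>B. basis_coordinates R M B v b \<odot>\<^bsub>M\<^esub> b) = v" using *(2) by simp
qed

lemma basis_coordinates_unique:
  assumes B: "finite_basis R M B" and d: "\<And>b. b \<in> B \<Longrightarrow> d b \<in> carrier R"
    and v: "v = (\<Oplus>\<^bsub>M\<^esub>b\<in>B. d b \<odot>\<^bsub>M\<^esub> b)" and b: "b \<in> B"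
  shows "basis_coordinates R M B v b = d b"
proof -
  have BM: "B \<subseteq> carrier M" using B by (simp add: finite_basis_def)
  have vM: "v \<in> carrier M" unfolding v using d BM by (intro M.finsum_closed) auto
  have "v = (\<Oplus>\<^bsub>M\<^esub>b\<in>B. restrict d B b \<odot>\<^bsub>M\<^esub> b)"
    unfolding v using d BM by (intro M.finsum_cong') auto
  then have "basis_coordinates R M B v = restrict d B"
    unfolding basis_coordinates_def using B vM d
    by (intro the1_equality) (auto simp: finite_basis_def)
  then show ?thesis using b by simp
qed

end

text \<open>
  The retraction \<open>\<psi>\<close> gives the vectors and the inclusion \<open>\<phi>\<close> the coordinates of the frame; the
  expansion of \<open>n\<close> is \<open>\<psi>\<close> applied to the expansion of \<open>\<phi> n\<close> in the basis.
\<close>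
lemma permutation_frame_of_retract:
  assumes N: "group_ring_module R H N" and P: "group_ring_module R H P"
    and B: "finite_basis R P B" and perm: "\<And>h. h \<in> carrier H \<Longrightarrow> act P h ` B = B"
    and \<phi>: "\<phi> \<in> equivariant_maps R H N P" and \<psi>: "\<psi> \<in> equivariant_maps R H P N"
    and retract: "\<And>n. n \<in> carrier N \<Longrightarrow> \<psi> (\<phi> n) = n"
  shows "permutation_frame R H N B (act P) \<psi> (\<lambda>n. basis_coordinates R P B (\<phi> n))"
proof -
  interpret N: group_ring_module R H N by fact
  interpret P: group_ring_module R H P by fact
  let ?k = "basis_coordinates R P B"
  have BP: "\<And>b. b \<in> B \<Longrightarrow> b \<in> carrier P" and fin: "finite B"
    using B by (auto simp: finite_basis_def)
  note k = P.basis_coordinates_closed[OF B] P.basis_coordinates_expansion[OF B]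
  note \<phi>c = equivariant_maps_closed[OF \<phi>]
  show ?thesis
  proof (intro permutation_frame.intro permutation_frame_axioms.intro N)
    show "finite B" by fact
    show bij: "bij_betw (act P h) B B" if "h \<in> carrier H" for h
      using perm[OF that] fin by (simp add: bij_betw_def eq_card_imp_inj_on)
    show "\<psi> x \<in> carrier N" if "x \<in> B" for x
      using equivariant_maps_closed[OF \<psi> BP[OF that]] .
    show "\<psi> (act P h x) = act N h (\<psi> x)" if "h \<in> carrier H" "x \<in> B" for h x
      using equivariant_maps_act[OF \<psi> that(1) BP[OF that(2)]] .
    show "?k (\<phi> n) x \<in> carrier R" if "n \<in> carrier N" "x \<in> B" for n x
      using k(1) \<phi>c that by blast
    show "?k (\<phi> (n \<oplus>\<^bsub>N\<^esub> n')) x = ?k (\<phi> n) x \<oplus>\<^bsub>R\<^esub> ?k (\<phi> n') x"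
      if n: "n \<in> carrier N" "n' \<in> carrier N" and x: "x \<in> B" for n n' x
    proof (rule P.basis_coordinates_unique[OF B _ _ x])
      show "?k (\<phi> n) b \<oplus>\<^bsub>R\<^esub> ?k (\<phi> n') b \<in> carrier R" if "b \<in> B" for b
        using k(1) \<phi>c n that by simp
      have "(\<Oplus>\<^bsub>P\<^esub>b\<in>B. (?k (\<phi> n) b \<oplus>\<^bsub>R\<^esub> ?k (\<phi> n') b) \<odot>\<^bsub>P\<^esub> b)
          = (\<Oplus>\<^bsub>P\<^esub>b\<in>B. ?k (\<phi> n) b \<odot>\<^bsub>P\<^esub> b \<oplus>\<^bsub>P\<^esub> ?k (\<phi> n') b \<odot>\<^bsub>P\<^esub> b)"
        using n k(1) \<phi>c BP by (intro P.M.finsum_cong') (auto simp: P.smult_l_distr)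
      also have "\<dots> = (\<Oplus>\<^bsub>P\<^esub>b\<in>B. ?k (\<phi> n) b \<odot>\<^bsub>P\<^esub> b) \<oplus>\<^bsub>P\<^esub> (\<Oplus>\<^bsub>P\<^esub>b\<in>B. ?k (\<phi> n') b \<odot>\<^bsub>P\<^esub> b)"
        using n k(1) \<phi>c BP by (intro P.M.finsum_addf) auto
      also have "\<dots> = \<phi> (n \<oplus>\<^bsub>N\<^esub> n')" using k(2) \<phi>c n equivariant_maps_add[OF \<phi>] by simp
      finally show "\<phi> (n \<oplus>\<^bsub>N\<^esub> n') = (\<Oplus>\<^bsub>P\<^esub>b\<in>B. (?k (\<phi> n) b \<oplus>\<^bsub>R\<^esub> ?k (\<phi> n') b) \<odot>\<^bsub>P\<^esub> b)" ..
    qed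
    show "?k (\<phi> (r \<odot>\<^bsub>N\<^esub> n)) x = r \<otimes>\<^bsub>R\<^esub> ?k (\<phi> n) x"
      if r: "r \<in> carrier R" and n: "n \<in> carrier N" and x: "x \<in> B" for r n x
    proof (rule P.basis_coordinates_unique[OF B _ _ x])
      show "r \<otimes>\<^bsub>R\<^esub> ?k (\<phi> n) b \<in> carrier R" if "b \<in> B" for b
        using k(1) \<phi>c n r that by simp
      have "(\<Oplus>\<^bsub>P\<^esub>b\<in>B. (r \<otimes>\<^bsub>R\<^esub> ?k (\<phi> n) b) \<odot>\<^bsub>P\<^esub> b) = (\<Oplus>\<^bsub>P\<^esub>b\<in>B. r \<odot>\<^bsub>P\<^esub> (?k (\<phi> n) b \<odot>\<^bsub>P\<^esub> b))"
        using n r k(1) \<phi>c BP by (intro P.M.finsum_cong') (auto simp: P.smult_assoc1)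
      also have "\<dots> = r \<odot>\<^bsub>P\<^esub> (\<Oplus>\<^bsub>P\<^esub>b\<in>B. ?k (\<phi> n) b \<odot>\<^bsub>P\<^esub> b)"
        using n r k(1) \<phi>c BP fin by (intro P.finsum_smult_ldistr[symmetric]) auto
      also have "\<dots> = \<phi> (r \<odot>\<^bsub>N\<^esub> n)" using k(2) \<phi>c n r equivariant_maps_smult[OF \<phi>] by simp
      finally show "\<phi> (r \<odot>\<^bsub>N\<^esub> n) = (\<Oplus>\<^bsub>P\<^esub>b\<in>B. (r \<otimes>\<^bsub>R\<^esub> ?k (\<phi> n) b) \<odot>\<^bsub>P\<^esub> b)" ..
    qed
    show "?k (\<phi> (act N h n)) (act P h x) = ?k (\<phi> n) x"
      if h: "h \<in> carrier H" and n: "n \<in> carrier N" and x: "x \<in> B" for h n x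
    proof -
      define g where "g = inv_into B (act P h)"
      have g: "g (act P h b) = b" if "b \<in> B" for b
        unfolding g_def using bij[OF h] that by (simp add: bij_betw_inv_into_left)
      have gB: "g b \<in> B" if "b \<in> B" for b
        unfolding g_def using bij[OF h] that by (meson bij_betwE bij_betw_inv_into)
      have "?k (\<phi> (act N h n)) (act P h x) = ?k (\<phi> n) (g (act P h x))"
      proof (rule P.basis_coordinates_unique[OF B])
        show "?k (\<phi> n) (g b) \<in> carrier R" if "b \<in> B" for b
          using k(1) \<phi>c n gB that by simp
        show "act P h x \<in> B" using perm h x by blast
        have "(\<Oplus>\<^bsub>P\<^esub>b\<in>B. ?k (\<phi> n) (g b) \<odot>\<^bsub>P\<^esub> b) = act P h (\<Oplus>\<^bsub>P\<^esub>b\<in>B. ?k (\<phi> n) b \<odot>\<^bsub>P\<^esub> b)"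
          using k(1) \<phi>c n BP g by (intro P.act_permuted_combination[OF h fin bij[OF h]]) auto
        also have "\<dots> = \<phi> (act N h n)" using k(2) \<phi>c n h equivariant_maps_act[OF \<phi>] by simp
        finally show "\<phi> (act N h n) = (\<Oplus>\<^bsub>P\<^esub>b\<in>B. ?k (\<phi> n) (g b) \<odot>\<^bsub>P\<^esub> b)" ..
      qed
      then show ?thesis using g x by simp
    qed
    show "n = (\<Oplus>\<^bsub>N\<^esub>x\<in>B. ?k (\<phi> n) x \<odot>\<^bsub>N\<^esub> \<psi> x)" if n: "n \<in> carrier N" for n
    proof -
      have "n = \<psi> (\<Oplus>\<^bsub>P\<^esub>b\<in>B. ?k (\<phi> n) b \<odot>\<^bsub>P\<^esub> b)" using k(2) \<phi>c n retract by simp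
      also have "\<dots> = (\<Oplus>\<^bsub>N\<^esub>b\<in>B. \<psi> (?k (\<phi> n) b \<odot>\<^bsub>P\<^esub> b))"
        using \<psi> k(1) \<phi>c n BP fin
        by (intro additive_finsum P.M.abelian_group_axioms N.M.abelian_group_axioms)
          (auto simp: equivariant_maps_def)
      also have "\<dots> = (\<Oplus>\<^bsub>N\<^esub>x\<in>B. ?k (\<phi> n) x \<odot>\<^bsub>N\<^esub> \<psi> x)"
        using equivariant_maps_closed[OF \<psi>] equivariant_maps_smult[OF \<psi>] k(1) \<phi>c n BP
        by (intro N.M.finsum_cong') auto
      finally show ?thesis .
    qed
  qed
qed

text \<open>
  The retraction is the projection along the complement followed by the inverse of the
  isomorphism with the summand. Both steps are made at once by describing \<open>\<psi> v\<close> as the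
  unique \<open>n\<close> for which \<open>v\<close> differs from \<open>\<phi> n\<close> by an element of the complement.
\<close>
lemma retract_of_direct_summand:
  assumes N: "group_ring_module R H N" and P: "group_ring_module R H P"
    and summand: "direct_summand R H N P"
  obtains \<phi> \<psi> where "\<phi> \<in> equivariant_maps R H N P" "\<psi> \<in> equivariant_maps R H P N"
    "\<forall>n \<in> carrier N. \<psi> (\<phi> n) = n"
proof -
  interpret N: group_ring_module R H N by fact
  interpret P: group_ring_module R H P by fact
  obtain A B where sub: "sub_gmodule R H P A" "sub_gmodule R H P B"
    and disj: "A \<inter> B = {\<zero>\<^bsub>P\<^esub>}" and sum: "A <+>\<^bsub>P\<^esub> B = carrier P"
    and iso: "gmodule_isomorphic R H N (P\<lparr>carrier := A\<rparr>)"
    using summand unfolding direct_summand_def by (elim exE conjE)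
  have A: "submodule A R P" and B: "submodule B R P"
    and actB: "\<And>h b. \<lbrakk>h \<in> carrier H; b \<in> B\<rbrakk> \<Longrightarrow> act P h b \<in> B"
    using sub unfolding sub_gmodule_def by blast+
  note AE = P.submoduleE[OF A] and BE = P.submoduleE[OF B]
  have AP: "a \<in> carrier P" if "a \<in> A" for a using AE(1) that by blast
  have BP: "b \<in> carrier P" if "b \<in> B" for b using BE(1) that by blast
  obtain \<phi> where \<phi>A: "\<phi> \<in> equivariant_maps R H N (P\<lparr>carrier := A\<rparr>)" and bij: "bij_betw \<phi> (carrier N) A"
    using iso unfolding gmodule_isomorphic_iff by auto
  have \<phi>: "\<phi> \<in> equivariant_maps R H N P"
    using \<phi>A AP unfolding equivariant_maps_def by auto
  have \<phi>A: "\<phi> n \<in> A" if "n \<in> carrier N" for n using bij that by (auto simp: bij_betw_def)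
  define \<psi> where "\<psi> v = (THE n. n \<in> carrier N \<and> (\<exists>b \<in> B. v = \<phi> n \<oplus>\<^bsub>P\<^esub> b))" for v
  have \<psi>_eq: "\<psi> (\<phi> n \<oplus>\<^bsub>P\<^esub> b) = n" if n: "n \<in> carrier N" and b: "b \<in> B" for n b
    unfolding \<psi>_def
  proof (rule the_equality)
    show "n \<in> carrier N \<and> (\<exists>b' \<in> B. \<phi> n \<oplus>\<^bsub>P\<^esub> b = \<phi> n \<oplus>\<^bsub>P\<^esub> b')" using n b by blast
  next
    fix n' assume "n' \<in> carrier N \<and> (\<exists>b' \<in> B. \<phi> n \<oplus>\<^bsub>P\<^esub> b = \<phi> n' \<oplus>\<^bsub>P\<^esub> b')"
    then obtain b' where n': "n' \<in> carrier N" and b': "b' \<in> B" "\<phi> n \<oplus>\<^bsub>P\<^esub> b = \<phi> n' \<oplus>\<^bsub>P\<^esub> b'" by blast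
    have c: "\<phi> n \<in> carrier P" "\<phi> n' \<in> carrier P" "b \<in> carrier P" "b' \<in> carrier P"
      using \<phi>A AP BP n n' b b' by auto
    \<comment> \<open>The difference lies in the summand and in its complement.\<close>
    let ?d = "\<ominus>\<^bsub>P\<^esub> \<phi> n' \<oplus>\<^bsub>P\<^esub> \<phi> n"
    have "?d = (\<ominus>\<^bsub>P\<^esub> \<phi> n' \<oplus>\<^bsub>P\<^esub> (\<phi> n \<oplus>\<^bsub>P\<^esub> b)) \<oplus>\<^bsub>P\<^esub> \<ominus>\<^bsub>P\<^esub> b"
      using c by (simp add: P.M.a_assoc P.M.r_neg)
    also have "\<dots> = b' \<oplus>\<^bsub>P\<^esub> \<ominus>\<^bsub>P\<^esub> b"
      unfolding b'(2) using c by (simp add: P.M.a_assoc[symmetric] P.M.l_neg)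
    finally have "?d \<in> B" using BE(3,5) b b' by simp
    moreover have "?d \<in> A" using AE(3,5) \<phi>A n n' by simp
    ultimately have "?d = \<zero>\<^bsub>P\<^esub>" using disj by blast
    then have "\<phi> n' \<oplus>\<^bsub>P\<^esub> ?d = \<phi> n'" using c by simp
    then have "\<phi> n = \<phi> n'" using c by (simp add: P.M.a_assoc[symmetric] P.M.r_neg)
    then show "n' = n" using bij n n' by (auto simp: bij_betw_def inj_on_def)
  qed
  have decomp: "\<exists>n b. n \<in> carrier N \<and> b \<in> B \<and> v = \<phi> n \<oplus>\<^bsub>P\<^esub> b" if "v \<in> carrier P" for v
  proof -
    obtain a b where "a \<in> A" "b \<in> B" "v = a \<oplus>\<^bsub>P\<^esub> b"
      using \<open>v \<in> carrier P\<close> unfolding sum[symmetric] by (auto simp: set_add_def')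
    moreover from this obtain n where "n \<in> carrier N" "a = \<phi> n" using bij by (auto simp: bij_betw_def)
    ultimately show ?thesis by blast
  qed
  have "\<psi> \<in> equivariant_maps R H P N"
    unfolding equivariant_maps_def
  proof (intro CollectI conjI ballI)
    show "\<psi> \<in> carrier P \<rightarrow> carrier N" using decomp \<psi>_eq by fastforce
  next
    fix v w assume "v \<in> carrier P" "w \<in> carrier P"
    then obtain n b m d where *: "n \<in> carrier N" "b \<in> B" "v = \<phi> n \<oplus>\<^bsub>P\<^esub> b"
      "m \<in> carrier N" "d \<in> B" "w = \<phi> m \<oplus>\<^bsub>P\<^esub> d" using decomp by metis
    then have "v \<oplus>\<^bsub>P\<^esub> w = \<phi> (n \<oplus>\<^bsub>N\<^esub> m) \<oplus>\<^bsub>P\<^esub> (b \<oplus>\<^bsub>P\<^esub> d)"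
      using equivariant_maps_add[OF \<phi>] equivariant_maps_closed[OF \<phi>] BP by (simp add: P.M.a_ac)
    then show "\<psi> (v \<oplus>\<^bsub>P\<^esub> w) = \<psi> v \<oplus>\<^bsub>N\<^esub> \<psi> w" using \<psi>_eq * BE(5) by simp
  next
    fix r v assume r: "r \<in> carrier R" and "v \<in> carrier P"
    then obtain n b where *: "n \<in> carrier N" "b \<in> B" "v = \<phi> n \<oplus>\<^bsub>P\<^esub> b" using decomp by metis
    then have "r \<odot>\<^bsub>P\<^esub> v = \<phi> (r \<odot>\<^bsub>N\<^esub> n) \<oplus>\<^bsub>P\<^esub> r \<odot>\<^bsub>P\<^esub> b"
      using equivariant_maps_smult[OF \<phi>] equivariant_maps_closed[OF \<phi>] BP r
      by (simp add: P.smult_r_distr)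
    then show "\<psi> (r \<odot>\<^bsub>P\<^esub> v) = r \<odot>\<^bsub>N\<^esub> \<psi> v" using \<psi>_eq * BE(4) r by simp
  next
    fix h v assume h: "h \<in> carrier H" and "v \<in> carrier P"
    then obtain n b where *: "n \<in> carrier N" "b \<in> B" "v = \<phi> n \<oplus>\<^bsub>P\<^esub> b" using decomp by metis
    then have "act P h v = \<phi> (act N h n) \<oplus>\<^bsub>P\<^esub> act P h b"
      using equivariant_maps_act[OF \<phi>] equivariant_maps_closed[OF \<phi>] BP h
      by (simp add: P.act_add)
    then show "\<psi> (act P h v) = act N h (\<psi> v)" using \<psi>_eq * actB h N.act_closed by simp
  qed
  moreover have "\<psi> (\<phi> n) = n" if "n \<in> carrier N" for n
    using \<psi>_eq[OF that, of "\<zero>\<^bsub>P\<^esub>"] disj equivariant_maps_closed[OF \<phi> that] by auto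
  ultimately show thesis using that \<phi> by blast
qed

lemma permutation_frame_of_invertible:
  fixes N :: "('r, 'm, 'h, 'k) gmodule_scheme"
  assumes "invertible_gmodule TYPE('c) R H N"
  shows "\<exists>(X :: 'c set) \<alpha> e c. permutation_frame R H N X \<alpha> e c"
proof -
  obtain P :: "('r, 'c, 'h) gmodule" where N: "group_ring_module R H N"
    and P: "group_ring_module R H P" and summand: "direct_summand R H N P"
    and "\<exists>B. finite_basis R P B \<and> (\<forall>h \<in> carrier H. act P h ` B = B)"
    using assms unfolding invertible_gmodule_def permutation_gmodule_def by blast
  then obtain B where B: "finite_basis R P B" "\<And>h. h \<in> carrier H \<Longrightarrow> act P h ` B = B" by blast
  obtain \<phi> \<psi> where "\<phi> \<in> equivariant_maps R H N P" "\<psi> \<in> equivariant_maps R H P N"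
    "\<forall>n \<in> carrier N. \<psi> (\<phi> n) = n"
    by (rule retract_of_direct_summand[OF N P summand])
  then show ?thesis using permutation_frame_of_retract[OF N P B] by blast
qed

section \<open>The localization of the integers at a prime\<close>

lemma Z_loc_simps [simp]:
  "x \<otimes>\<^bsub>Z_loc p\<^esub> y = x * y" "x \<oplus>\<^bsub>Z_loc p\<^esub> y = x + y" "\<one>\<^bsub>Z_loc p\<^esub> = 1" "\<zero>\<^bsub>Z_loc p\<^esub> = 0"
  by (simp_all add: Z_loc_def)

lemma Z_loc_carrierE:
  assumes "q \<in> carrier (Z_loc p)"
  obtains a b where "\<not> int p dvd b" "b \<noteq> 0" "q = of_int a / of_int b"
  using assms that by (auto simp: Z_loc_def)

lemma Z_loc_carrierI: "\<not> int p dvd b \<Longrightarrow> of_int a / of_int b \<in> carrier (Z_loc p)"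
  by (auto simp: Z_loc_def)

context
  fixes p :: nat
  assumes p: "prime p"
begin

lemma not_p_dvd_mult: "\<not> int p dvd b \<Longrightarrow> \<not> int p dvd d \<Longrightarrow> \<not> int p dvd b * d"
  using p by (simp add: prime_dvd_mult_iff)

lemma Z_loc_of_int: "of_int a \<in> carrier (Z_loc p)"
proof -
  have "\<not> int p dvd 1" using prime_gt_1_nat[OF p] by (simp add: zdvd_not_zless)
  then show ?thesis using Z_loc_carrierI[of p 1 a] by simp
qed

lemma Z_loc_of_nat: "of_nat a \<in> carrier (Z_loc p)"
  using Z_loc_of_int[of "int a"] by simp

lemma Z_loc_mult_closed:
  assumes "x \<in> carrier (Z_loc p)" "y \<in> carrier (Z_loc p)"
  shows "x * y \<in> carrier (Z_loc p)"
proof -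
  obtain a b where x: "\<not> int p dvd b" "b \<noteq> 0" "x = of_int a / of_int b" using assms(1) by (rule Z_loc_carrierE)
  obtain c d where y: "\<not> int p dvd d" "d \<noteq> 0" "y = of_int c / of_int d" using assms(2) by (rule Z_loc_carrierE)
  have "x * y = of_int (a * c) / of_int (b * d)" using x y by simp
  then show ?thesis using Z_loc_carrierI[OF not_p_dvd_mult[OF x(1) y(1)]] by metis
qed

lemma Z_loc_add_closed:
  assumes "x \<in> carrier (Z_loc p)" "y \<in> carrier (Z_loc p)"
  shows "x + y \<in> carrier (Z_loc p)"
proof -
  obtain a b where x: "\<not> int p dvd b" "b \<noteq> 0" "x = of_int a / of_int b" using assms(1) by (rule Z_loc_carrierE)
  obtain c d where y: "\<not> int p dvd d" "d \<noteq> 0" "y = of_int c / of_int d" using assms(2) by (rule Z_loc_carrierE)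
  have "x + y = of_int (a * d + c * b) / of_int (b * d)" using x y by (simp add: field_simps)
  then show ?thesis using Z_loc_carrierI[OF not_p_dvd_mult[OF x(1) y(1)]] by metis
qed

lemma Z_loc_uminus_closed: "x \<in> carrier (Z_loc p) \<Longrightarrow> - x \<in> carrier (Z_loc p)"
  using Z_loc_mult_closed[OF Z_loc_of_int[of "-1"]] by simp

lemma Z_loc_cring: "cring (Z_loc p)"
proof (rule cringI)
  show "abelian_group (Z_loc p)"
  proof (rule abelian_groupI)
    show "\<exists>y\<in>carrier (Z_loc p). y \<oplus>\<^bsub>Z_loc p\<^esub> x = \<zero>\<^bsub>Z_loc p\<^esub>" if "x \<in> carrier (Z_loc p)" for x
      using Z_loc_uminus_closed[OF that] by (intro bexI[of _ "- x"]) auto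
  qed (use Z_loc_of_int[of 0] in \<open>auto simp: Z_loc_add_closed\<close>)
  show "comm_monoid (Z_loc p)"
    by (rule comm_monoidI) (use Z_loc_of_int[of 1] in \<open>auto simp: Z_loc_mult_closed\<close>)
qed (auto simp: algebra_simps)

lemma Z_loc_one_minus_unit:
  assumes "a \<in> carrier (Z_loc p)"
  shows "\<one>\<^bsub>Z_loc p\<^esub> \<ominus>\<^bsub>Z_loc p\<^esub> of_nat p \<otimes>\<^bsub>Z_loc p\<^esub> a \<in> Units (Z_loc p)"
proof -
  interpret cring "Z_loc p" by (rule Z_loc_cring)
  obtain u v where a: "\<not> int p dvd v" "v \<noteq> 0" "a = of_int u / of_int v" using assms by (rule Z_loc_carrierE)
  have pa: "of_nat p * a \<in> carrier (Z_loc p)" using Z_loc_mult_closed[OF Z_loc_of_nat assms] .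
  have "\<ominus>\<^bsub>Z_loc p\<^esub> (of_nat p * a) = - (of_nat p * a)"
    by (rule minus_equality) (use pa Z_loc_uminus_closed in auto)
  then have eq: "\<one>\<^bsub>Z_loc p\<^esub> \<ominus>\<^bsub>Z_loc p\<^esub> of_nat p \<otimes>\<^bsub>Z_loc p\<^esub> a = 1 - of_nat p * a"
    by (simp add: minus_eq)
  have nd: "\<not> int p dvd v - int p * u" using a(1) by (simp add: dvd_diff_left_iff)
  then have nz: "v - int p * u \<noteq> 0" by auto
  have x: "1 - of_nat p * a = of_int (v - int p * u) / of_int v"
    using a by (simp add: field_simps)
  let ?y = "of_int v / of_int (v - int p * u) :: rat"
  have "(1 - of_nat p * a) * ?y = 1" unfolding x using a(2) nz by (simp del: of_int_diff)
  moreover have "?y \<in> carrier (Z_loc p)" by (rule Z_loc_carrierI[OF nd])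
  moreover have "1 - of_nat p * a \<in> carrier (Z_loc p)" unfolding x by (rule Z_loc_carrierI[OF a(1)])
  ultimately show ?thesis unfolding eq Units_def by (auto simp: mult.commute intro!: bexI[of _ ?y])
qed

lemma Z_loc_separated:
  assumes a: "a \<in> carrier (Z_loc p)"
    and div: "\<forall>k::nat. \<exists>b \<in> carrier (Z_loc p). a = of_nat p [^]\<^bsub>Z_loc p\<^esub> k \<otimes>\<^bsub>Z_loc p\<^esub> b"
  shows "a = 0"
proof -
  interpret cring "Z_loc p" by (rule Z_loc_cring)
  have pow: "of_nat p [^]\<^bsub>Z_loc p\<^esub> k = (of_nat (p ^ k) :: rat)" for k
    by (induction k) (simp_all add: mult.commute)
  obtain n d where d: "\<not> int p dvd d" "d \<noteq> 0" "a = of_int n / of_int d" using a by (rule Z_loc_carrierE)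
  have "int p ^ k dvd n" for k
  proof -
    obtain b where b: "b \<in> carrier (Z_loc p)" "a = of_nat (p ^ k) * b" using div pow by auto
    obtain u v where v: "\<not> int p dvd v" "v \<noteq> 0" "b = of_int u / of_int v" using b(1) by (rule Z_loc_carrierE)
    have "of_int (n * v) = (of_int (int p ^ k * u * d) :: rat)"
      using b(2) d v by (simp add: field_simps)
    then have "n * v = int p ^ k * u * d" by (simp only: of_int_eq_iff)
    then have "int p ^ k dvd n * v" by simp
    moreover have "coprime (int p ^ k) v"
      using p v(1) by (simp add: prime_imp_coprime)
    ultimately show ?thesis by (simp add: coprime_dvd_mult_left_iff)
  qed
  moreover have "\<exists>k. \<bar>n\<bar> < int p ^ k"
  proof -
    have "nat \<bar>n\<bar> < p ^ nat \<bar>n\<bar>" using power_gt_expt[of p] prime_gt_1_nat[OF p] by simp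
    then have "int (nat \<bar>n\<bar>) < int (p ^ nat \<bar>n\<bar>)" by (simp only: of_nat_less_iff)
    then show ?thesis by auto
  qed
  ultimately obtain k where "int p ^ k dvd \<bar>n\<bar>" "\<bar>n\<bar> < int p ^ k" by auto
  then have "n = 0" using zdvd_not_zless[of "\<bar>n\<bar>" "int p ^ k"] by fastforce
  then show ?thesis using d by simp
qed

text \<open>
  The denominator \<open>b\<close> has an inverse \<open>c\<close> modulo \<open>p\<close>, and the residue of \<open>a c\<close> represents
  \<open>a / b\<close>. Hence scalar multiplication modulo \<open>p\<close> reduces to repeated addition.
\<close>
lemma Z_loc_residue:
  assumes "q \<in> carrier (Z_loc p)"
  obtains k :: nat and s where "s \<in> carrier (Z_loc p)" "q = of_nat k + of_nat p * s"
proof -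
  obtain a b where q: "\<not> int p dvd b" "b \<noteq> 0" "q = of_int a / of_int b" using assms by (rule Z_loc_carrierE)
  have p0: "int p > 0" using p by (simp add: prime_gt_0_nat)
  have "coprime b (int p)" using prime_imp_coprime[of "int p" b] p q(1) by (simp add: coprime_commute)
  then obtain c where "[b * c = 1] (mod int p)" using cong_solve_coprime_int by blast
  then have "[a * (b * c) = a * 1] (mod int p)" by (rule cong_scalar_left)
  moreover have "[(a * c) mod int p * b = a * c * b] (mod int p)" by (simp add: cong_def mod_mult_left_eq)
  ultimately have "[a = (a * c) mod int p * b] (mod int p)"
    by (simp add: cong_def mult_ac)
  then obtain m where m: "a = (a * c) mod int p * b + int p * m"
    by (metis cong_iff_lin cong_sym mult.commute)
  let ?k = "nat ((a * c) mod int p)"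
  have k: "int ?k = (a * c) mod int p" using p0 by simp
  have "q = of_int (int ?k * b + int p * m) / of_int b" using q(3) m k by simp
  also have "\<dots> = of_nat ?k + of_nat p * (of_int m / of_int b)" using q(2) by (simp add: field_simps)
  finally show thesis using that Z_loc_carrierI[OF q(1)] by blast
qed

end

section \<open>Reduction modulo a prime as a tensor product\<close>

locale local_gmodule = group_ring_module "Z_loc p" H M
  for p :: nat and H :: "('h, 'j) monoid_scheme" (structure)
    and M :: "(rat, 'm, 'h, 'k) gmodule_scheme" (structure) +
  assumes p: "prime p"
begin

abbreviation "K \<equiv> residue_ring (int p)"
abbreviation "G \<equiv> pairs_group M K"
abbreviation "relations \<equiv> tensor_relations M K"

lemma K_carrier: "a \<in> carrier K \<longleftrightarrow> 0 \<le> a \<and> a < int p"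
  by (auto simp: residue_ring_def)

lemma K_add: "a \<oplus>\<^bsub>K\<^esub> b = (a + b) mod int p"
  by (simp add: residue_ring_def)

lemma one_in_K: "1 \<in> carrier K" and zero_in_K: "0 \<in> carrier K"
  using prime_gt_1_nat[OF p] by (auto simp: K_carrier)

lemma G_comm: "comm_group G" by (rule abelian_free_Abelian_group)

lemma G_keys: "\<lbrakk>x \<in> carrier M; a \<in> carrier K\<rbrakk> \<Longrightarrow> frag_of (x, a) \<in> carrier G"
  by simp

lemma G_diff: "\<lbrakk>u \<in> carrier G; v \<in> carrier G\<rbrakk> \<Longrightarrow> u - v \<in> carrier G"
  by (simp) (meson Un_least keys_diff order_trans)

lemma relations_subgroup: "subgroup relations G"
  unfolding tensor_relations_def
proof (rule group.generate_is_subgroup)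
  show "group G" by simp
  have K: "a \<oplus>\<^bsub>K\<^esub> b \<in> carrier K" if "a \<in> carrier K" for a b
    using that by (auto simp: K_carrier K_add)
  show "{frag_of (x \<oplus>\<^bsub>M\<^esub> y, a) - frag_of (x, a) - frag_of (y, a) | x y a.
        x \<in> carrier M \<and> y \<in> carrier M \<and> a \<in> carrier K} \<union>
     {frag_of (x, a \<oplus>\<^bsub>K\<^esub> b) - frag_of (x, a) - frag_of (x, b) | x a b.
        x \<in> carrier M \<and> a \<in> carrier K \<and> b \<in> carrier K} \<subseteq> carrier G"
    by (auto intro!: G_diff G_keys K simp del: carrier_free_Abelian_group_iff)
qed

lemma relations_sub: "r \<in> relations \<Longrightarrow> r \<in> carrier G"
  using subgroup.subset[OF relations_subgroup] by blast

lemma relations_zero: "0 \<in> relations"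
  using subgroup.one_closed[OF relations_subgroup] by simp

lemma relations_add: "\<lbrakk>r \<in> relations; s \<in> relations\<rbrakk> \<Longrightarrow> r + s \<in> relations"
  using subgroup.m_closed[OF relations_subgroup] by simp

lemma relations_uminus: "r \<in> relations \<Longrightarrow> - r \<in> relations"
  using subgroup.m_inv_closed[OF relations_subgroup, of r] relations_sub[of r] by simp

lemma relations_diff: "\<lbrakk>r \<in> relations; s \<in> relations\<rbrakk> \<Longrightarrow> r - s \<in> relations"
  using relations_add[OF _ relations_uminus, of r s] by simp

lemma relation_left:
  "\<lbrakk>x \<in> carrier M; y \<in> carrier M; a \<in> carrier K\<rbrakk>
    \<Longrightarrow> frag_of (x \<oplus>\<^bsub>M\<^esub> y, a) - frag_of (x, a) - frag_of (y, a) \<in> relations"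
  unfolding tensor_relations_def by (rule generate.incl) blast

lemma relation_right:
  "\<lbrakk>x \<in> carrier M; a \<in> carrier K; b \<in> carrier K\<rbrakk>
    \<Longrightarrow> frag_of (x, a \<oplus>\<^bsub>K\<^esub> b) - frag_of (x, a) - frag_of (x, b) \<in> relations"
  unfolding tensor_relations_def by (rule generate.incl) blast

text \<open>
  Closure under differences covers both inverses and sums, so it replaces the last two of
  the rules that generate a subgroup.
\<close>
lemma relations_induct [consumes 1, case_names zero left right diff]:
  assumes "r \<in> relations" and "P 0"
    and left: "\<And>x y a. \<lbrakk>x \<in> carrier M; y \<in> carrier M; a \<in> carrier K\<rbrakk>
      \<Longrightarrow> P (frag_of (x \<oplus>\<^bsub>M\<^esub> y, a) - frag_of (x, a) - frag_of (y, a))"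
    and right: "\<And>x a b. \<lbrakk>x \<in> carrier M; a \<in> carrier K; b \<in> carrier K\<rbrakk>
      \<Longrightarrow> P (frag_of (x, a \<oplus>\<^bsub>K\<^esub> b) - frag_of (x, a) - frag_of (x, b))"
    and diff: "\<And>r s. \<lbrakk>r \<in> relations; s \<in> relations; P r; P s\<rbrakk> \<Longrightarrow> P (r - s)"
  shows "P r"
proof -
  have neg: "P (- r)" if "P r" "r \<in> relations" for r
    using diff[OF relations_zero that(2) \<open>P 0\<close> that(1)] by simp
  have "r \<in> relations \<and> P r"
    using assms(1) unfolding tensor_relations_def
  proof (induction r rule: generate.induct)
    case one
    then show ?case using \<open>P 0\<close> relations_zero by (simp add: tensor_relations_def)
  next
    case (incl r)
    then have "r \<in> relations" unfolding tensor_relations_def by (rule generate.incl)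
    moreover have "P r" using incl left right by blast
    ultimately show ?case by (simp add: tensor_relations_def)
  next
    case (inv r)
    then have r: "r \<in> relations" unfolding tensor_relations_def by (rule generate.incl)
    have "P r" using inv left right by blast
    then have "- r \<in> relations \<and> P (- r)" using r neg relations_uminus by blast
    moreover have "inv\<^bsub>G\<^esub> r = - r" using relations_sub[OF r] by simp
    ultimately show ?case by (simp add: tensor_relations_def)
  next
    case (eng r s)
    then have r: "r \<in> relations" "s \<in> relations" "P r" "P s" by (auto simp: tensor_relations_def)
    have "P (r - (- s))" by (rule diff) (use r neg relations_uminus in auto)
    then have "r + s \<in> relations \<and> P (r + s)" using relations_add r by simp
    then show ?case by (simp add: tensor_relations_def)
  qed
  then show ?thesis by blast
qed

lemma of_nat_smult_closed: "x \<in> carrier M \<Longrightarrow> of_nat k \<odot>\<^bsub>M\<^esub> x \<in> carrier M"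
  using Z_loc_of_nat[OF p] by simp

lemma of_nat_Suc_smult:
  assumes "x \<in> carrier M"
  shows "of_nat (Suc k) \<odot>\<^bsub>M\<^esub> x = of_nat k \<odot>\<^bsub>M\<^esub> x \<oplus>\<^bsub>M\<^esub> x"
  using smult_l_distr[OF Z_loc_of_nat[OF p] Z_loc_of_nat[OF p] assms, of k 1] smult_one[OF assms]
  by (simp add: add.commute)

lemma tensor_zero_right: "x \<in> carrier M \<Longrightarrow> frag_of (x, 0) \<in> relations"
  using relations_uminus[OF relation_right[OF _ zero_in_K zero_in_K, of x]] by (simp add: K_add)

lemma tensor_zero_left: "frag_of (\<zero>\<^bsub>M\<^esub>, 1) \<in> relations"
  using relations_uminus[OF relation_left[OF _ _ one_in_K, of "\<zero>\<^bsub>M\<^esub>" "\<zero>\<^bsub>M\<^esub>"]] by simp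

text \<open>
  The tensors of \<open>x\<close> with \<open>k\<close> and of \<open>k x\<close> with \<open>1\<close> agree. The bound on \<open>k\<close> keeps the integer \<open>k\<close>
  inside the carrier of the residue ring, where adding \<open>1\<close> does not wrap around.
\<close>
lemma tensor_move_scalar:
  assumes x: "x \<in> carrier M"
  shows "k < p \<Longrightarrow> frag_of (x, int k) - frag_of (of_nat k \<odot>\<^bsub>M\<^esub> x, 1) \<in> relations"
proof (induction k)
  case 0
  have "0 \<odot>\<^bsub>M\<^esub> x = \<zero>\<^bsub>M\<^esub>" using smult_l_null[OF x] by simp
  then show ?case using relations_diff[OF tensor_zero_right[OF x] tensor_zero_left] by simp
next
  case (Suc k)
  let ?y = "of_nat k \<odot>\<^bsub>M\<^esub> x"
  have k: "int k \<in> carrier K" using Suc by (simp add: K_carrier)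
  have "int k \<oplus>\<^bsub>K\<^esub> 1 = int (Suc k)" using Suc by (simp add: K_add)
  then have right: "frag_of (x, int (Suc k)) - frag_of (x, int k) - frag_of (x, 1) \<in> relations"
    using relation_right[OF x k one_in_K] by simp
  have left: "frag_of (of_nat (Suc k) \<odot>\<^bsub>M\<^esub> x, 1) - frag_of (?y, 1) - frag_of (x, 1) \<in> relations"
    unfolding of_nat_Suc_smult[OF x] by (rule relation_left[OF of_nat_smult_closed[OF x] x one_in_K])
  have "(frag_of (x, int (Suc k)) - frag_of (x, int k) - frag_of (x, 1))
      - (frag_of (of_nat (Suc k) \<odot>\<^bsub>M\<^esub> x, 1) - frag_of (?y, 1) - frag_of (x, 1))
      + (frag_of (x, int k) - frag_of (?y, 1)) \<in> relations"
    using Suc.IH Suc.prems by (intro relations_add[OF relations_diff[OF right left]]) simp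
  then show ?case by (simp add: algebra_simps)
qed

text \<open>
  Here the addition wraps around once: the sum of \<open>p - 1\<close> and \<open>1\<close> in the residue ring is \<open>0\<close>,
  so the tensor of \<open>p x\<close> with \<open>1\<close> equals that of \<open>x\<close> with \<open>0\<close>.
\<close>
lemma tensor_p_multiple:
  assumes x: "x \<in> carrier M"
  shows "frag_of (of_nat p \<odot>\<^bsub>M\<^esub> x, 1) \<in> relations"
proof -
  obtain k where k: "p = Suc k" using prime_gt_0_nat[OF p] gr0_implies_Suc by blast
  let ?y = "of_nat k \<odot>\<^bsub>M\<^esub> x"
  have kK: "int k \<in> carrier K" unfolding K_carrier using k by simp
  have "int k + 1 = int p" using k by simp
  then have "int k \<oplus>\<^bsub>K\<^esub> 1 = 0" by (simp only: K_add mod_self)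
  then have "frag_of (x, 0) - frag_of (x, int k) - frag_of (x, 1) \<in> relations"
    using relation_right[OF x kK one_in_K] by simp
  moreover have "frag_of (of_nat p \<odot>\<^bsub>M\<^esub> x, 1) - frag_of (?y, 1) - frag_of (x, 1) \<in> relations"
    using relation_left[OF of_nat_smult_closed[OF x, of k] x one_in_K] of_nat_Suc_smult[OF x, of k] k by simp
  moreover have "frag_of (x, int k) - frag_of (?y, 1) \<in> relations"
    using tensor_move_scalar[OF x, of k] k by simp
  ultimately have "(frag_of (of_nat p \<odot>\<^bsub>M\<^esub> x, 1) - frag_of (?y, 1) - frag_of (x, 1))
      - (frag_of (x, 0) - frag_of (x, int k) - frag_of (x, 1))
      - (frag_of (x, int k) - frag_of (?y, 1)) + frag_of (x, 0) \<in> relations"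
    using relations_add[OF relations_diff[OF relations_diff] tensor_zero_right[OF x]] by blast
  then show ?thesis by (simp add: algebra_simps)
qed

lemma tensor_with_one:
  assumes "u \<in> carrier G"
  shows "\<exists>x \<in> carrier M. u - frag_of (x, 1) \<in> relations"
proof -
  have "Poly_Mapping.keys u \<subseteq> carrier M \<times> carrier K" using assms by simp
  then show ?thesis
  proof (induction u rule: free_Abelian_group_induct[consumes 1, case_names zero diff generator])
    case zero
    then show ?case using relations_uminus[OF tensor_zero_left] by force
  next
    case (diff u v)
    then obtain x y where x: "x \<in> carrier M" "u - frag_of (x, 1) \<in> relations"
      and y: "y \<in> carrier M" "v - frag_of (y, 1) \<in> relations" by blast
    let ?z = "x \<ominus>\<^bsub>M\<^esub> y"
    have z: "?z \<in> carrier M" "?z \<oplus>\<^bsub>M\<^esub> y = x" using x y by (auto simp: M.minus_eq M.a_assoc M.l_neg)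
    have "(u - frag_of (x, 1)) - (v - frag_of (y, 1))
        + (frag_of (?z \<oplus>\<^bsub>M\<^esub> y, 1) - frag_of (?z, 1) - frag_of (y, 1)) \<in> relations"
      by (rule relations_add[OF relations_diff[OF x(2) y(2)] relation_left[OF z(1) y(1) one_in_K]])
    then have "u - v - frag_of (?z, 1) \<in> relations" unfolding z(2) by (simp add: algebra_simps)
    then show ?case using z(1) by blast
  next
    case (generator g)
    then obtain x a where g: "g = (x, a)" "x \<in> carrier M" "0 \<le> a" "a < int p" by (auto simp: K_carrier)
    then have "frag_of (x, int (nat a)) - frag_of (of_nat (nat a) \<odot>\<^bsub>M\<^esub> x, 1) \<in> relations"
      by (intro tensor_move_scalar) auto
    then show ?case using g of_nat_smult_closed[OF g(2), of "nat a"] by auto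
  qed
qed

text \<open>
  The map \<open>(x, a) \<mapsto> a x\<close> extends to a homomorphism \<open>h\<close> from the free abelian group to \<open>M\<close>. The map
  is biadditive only modulo \<open>p M\<close>, since representatives of residues are added with reduction;
  so it sends all relations into \<open>p M\<close>, while it sends the generator \<open>(x, 1)\<close> to \<open>x\<close>.
\<close>
lemma tensor_kernel:
  assumes x: "x \<in> carrier M" and rel: "frag_of (x, 1) \<in> relations"
  shows "\<exists>z \<in> carrier M. x = of_nat p \<odot>\<^bsub>M\<^esub> z"
proof -
  let ?f = "\<lambda>(x, a). of_int a \<odot>\<^bsub>M\<^esub> x"
  let ?A = "add_monoid M"
  have smc: "of_int a \<odot>\<^bsub>M\<^esub> y \<in> carrier M" if "y \<in> carrier M" for a y
    using that Z_loc_of_int[OF p] by simp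
  obtain h where hom: "h \<in> hom G ?A" and h: "\<And>g. g \<in> carrier M \<times> carrier K \<Longrightarrow> h (frag_of g) = ?f g"
    using comm_group.free_Abelian_group_universal[OF M.a_comm_group, of ?f "carrier M \<times> carrier K"] smc
    by (auto simp: image_subset_iff)
  interpret h: group_hom G ?A h
    using hom M.a_group by (simp add: group_hom_def group_hom_axioms_def)
  \<comment> \<open>The image of a biadditivity relation under \<open>h\<close> has this shape, with \<open>w\<close> in \<open>p M\<close>.\<close>
  have cancel: "(u \<oplus>\<^bsub>M\<^esub> v \<oplus>\<^bsub>M\<^esub> w) \<ominus>\<^bsub>M\<^esub> u \<ominus>\<^bsub>M\<^esub> v = w"
    if "u \<in> carrier M" "v \<in> carrier M" "w \<in> carrier M" for u v w
  proof -
    have "(u \<oplus>\<^bsub>M\<^esub> v \<oplus>\<^bsub>M\<^esub> w) \<ominus>\<^bsub>M\<^esub> u \<ominus>\<^bsub>M\<^esub> v = w \<oplus>\<^bsub>M\<^esub> ((u \<oplus>\<^bsub>M\<^esub> v) \<oplus>\<^bsub>M\<^esub> \<ominus>\<^bsub>M\<^esub> (u \<oplus>\<^bsub>M\<^esub> v))"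
      using that by (simp add: M.minus_eq M.minus_add M.a_ac)
    also have "\<dots> = w" using that by (simp add: M.r_neg)
    finally show ?thesis .
  qed
  have h_diff: "h (u - v) = h u \<ominus>\<^bsub>M\<^esub> h v" if "u \<in> carrier G" "v \<in> carrier G" for u v
  proof -
    have "h (u - v) = h u \<oplus>\<^bsub>M\<^esub> inv\<^bsub>?A\<^esub> h v"
      using that h.hom_mult[of u "- v"] h.hom_inv[of v] by simp
    then show ?thesis by (simp add: M.minus_eq a_inv_def)
  qed
  have "\<exists>z \<in> carrier M. h r = of_nat p \<odot>\<^bsub>M\<^esub> z" if "r \<in> relations" for r
    using that
  proof (induction r rule: relations_induct)
    case zero
    have "h 0 = \<zero>\<^bsub>M\<^esub>" using h.hom_one by simp
    also have "\<dots> = of_nat p \<odot>\<^bsub>M\<^esub> \<zero>\<^bsub>M\<^esub>" using Z_loc_of_nat[OF p] by simp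
    finally show ?case by blast
  next
    case (left x y a)
    have "h (frag_of (x \<oplus>\<^bsub>M\<^esub> y, a) - frag_of (x, a) - frag_of (y, a))
      = of_int a \<odot>\<^bsub>M\<^esub> (x \<oplus>\<^bsub>M\<^esub> y) \<ominus>\<^bsub>M\<^esub> of_int a \<odot>\<^bsub>M\<^esub> x \<ominus>\<^bsub>M\<^esub> of_int a \<odot>\<^bsub>M\<^esub> y"
      using left by (simp add: h_diff h G_diff del: carrier_free_Abelian_group_iff)
    also have "\<dots> = (of_int a \<odot>\<^bsub>M\<^esub> x \<oplus>\<^bsub>M\<^esub> of_int a \<odot>\<^bsub>M\<^esub> y) \<ominus>\<^bsub>M\<^esub> of_int a \<odot>\<^bsub>M\<^esub> x \<ominus>\<^bsub>M\<^esub> of_int a \<odot>\<^bsub>M\<^esub> y"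
      using left Z_loc_of_int[OF p] by (simp add: smult_r_distr)
    also have "\<dots> = \<zero>\<^bsub>M\<^esub>"
      using cancel[OF smc[OF left(1), of a] smc[OF left(2), of a] M.zero_closed]
        smc[OF left(1), of a] smc[OF left(2), of a] by simp
    also have "\<dots> = of_nat p \<odot>\<^bsub>M\<^esub> \<zero>\<^bsub>M\<^esub>" using Z_loc_of_nat[OF p] by simp
    finally show ?case by blast
  next
    case (right x a b)
    define m where "m = (a + b) div int p"
    have ab: "(a + b) mod int p = a + b + int p * (- m)"
      unfolding m_def by (simp add: minus_mult_div_eq_mod[symmetric])
    have "(a + b) mod int p \<in> carrier K" using prime_gt_0_nat[OF p] by (simp add: K_carrier)
    then have "h (frag_of (x, a \<oplus>\<^bsub>K\<^esub> b) - frag_of (x, a) - frag_of (x, b))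
      = of_int ((a + b) mod int p) \<odot>\<^bsub>M\<^esub> x \<ominus>\<^bsub>M\<^esub> of_int a \<odot>\<^bsub>M\<^esub> x \<ominus>\<^bsub>M\<^esub> of_int b \<odot>\<^bsub>M\<^esub> x"
      using right by (simp add: h_diff h G_diff K_add del: carrier_free_Abelian_group_iff)
    also have "of_int ((a + b) mod int p) \<odot>\<^bsub>M\<^esub> x = of_int (a + b + int p * (- m)) \<odot>\<^bsub>M\<^esub> x"
      by (simp only: ab)
    also have "of_int (a + b + int p * (- m)) \<odot>\<^bsub>M\<^esub> x
        = of_int a \<odot>\<^bsub>M\<^esub> x \<oplus>\<^bsub>M\<^esub> of_int b \<odot>\<^bsub>M\<^esub> x \<oplus>\<^bsub>M\<^esub> of_nat p \<odot>\<^bsub>M\<^esub> (of_int (- m) \<odot>\<^bsub>M\<^esub> x)"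
    proof -
      have eq: "of_int (a + b + int p * (- m)) = (of_int a + of_int b) + of_nat p * (of_int (- m) :: rat)"
        by simp
      show ?thesis
        unfolding eq
        using smult_l_distr[of "of_int a + of_int b" "of_nat p * of_int (- m)" x]
          smult_l_distr[of "of_int a" "of_int b" x] smult_assoc1[of "of_nat p" "of_int (- m)" x]
          right(1) Z_loc_of_int[OF p] Z_loc_of_nat[OF p] Z_loc_add_closed[OF p] Z_loc_mult_closed[OF p]
        by (simp del: of_int_minus)
    qed
    also have "\<dots> \<ominus>\<^bsub>M\<^esub> of_int a \<odot>\<^bsub>M\<^esub> x \<ominus>\<^bsub>M\<^esub> of_int b \<odot>\<^bsub>M\<^esub> x = of_nat p \<odot>\<^bsub>M\<^esub> (of_int (- m) \<odot>\<^bsub>M\<^esub> x)"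
      by (rule cancel[OF smc smc of_nat_smult_closed[OF smc]]) (rule right(1))+
    finally show ?case using smc[OF right(1)] by blast
  next
    case (diff r s)
    then obtain z w where z: "z \<in> carrier M" "h r = of_nat p \<odot>\<^bsub>M\<^esub> z"
      and w: "w \<in> carrier M" "h s = of_nat p \<odot>\<^bsub>M\<^esub> w" by blast
    have "h (r - s) = of_nat p \<odot>\<^bsub>M\<^esub> (z \<ominus>\<^bsub>M\<^esub> w)"
      using h_diff[OF relations_sub relations_sub] diff z w Z_loc_of_nat[OF p]
      by (simp add: M.minus_eq smult_r_distr smult_r_minus)
    then show ?case using z w by blast
  qed
  moreover have "h (frag_of (x, 1)) = x"
    using h[of "(x, 1)"] x one_in_K smult_one[OF x] by simp
  ultimately show ?thesis using rel by force
qed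

abbreviation "T \<equiv> tensor_gmodule M K"

definition tensor_one :: "'m \<Rightarrow> ('m \<times> int \<Rightarrow>\<^sub>0 int) set"
  where "tensor_one x = relations #>\<^bsub>G\<^esub> frag_of (x, 1)"

lemma coset_eq_iff: "relations #>\<^bsub>G\<^esub> u = relations #>\<^bsub>G\<^esub> v \<longleftrightarrow> u - v \<in> relations"
proof
  assume "relations #>\<^bsub>G\<^esub> u = relations #>\<^bsub>G\<^esub> v"
  then have "0 + u \<in> relations #>\<^bsub>G\<^esub> v" using relations_zero by (auto simp: r_coset_def)
  then show "u - v \<in> relations" by (auto simp: r_coset_def)
next
  assume uv: "u - v \<in> relations"
  have sub: "relations #>\<^bsub>G\<^esub> u \<subseteq> relations #>\<^bsub>G\<^esub> v" if "u - v \<in> relations" for u v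
  proof
    fix w assume "w \<in> relations #>\<^bsub>G\<^esub> u"
    then obtain t where t: "t \<in> relations" "w = t + u" by (auto simp: r_coset_def)
    then have "w = (t + (u - v)) + v" by simp
    moreover have "t + (u - v) \<in> relations" using relations_add t(1) that .
    ultimately show "w \<in> relations #>\<^bsub>G\<^esub> v" by (force simp: r_coset_def)
  qed
  have "v - u \<in> relations" using relations_uminus[OF uv] by simp
  then show "relations #>\<^bsub>G\<^esub> u = relations #>\<^bsub>G\<^esub> v" using sub uv by blast
qed

lemma tensor_one_closed: "x \<in> carrier M \<Longrightarrow> tensor_one x \<in> carrier T"
  unfolding tensor_one_def tensor_gmodule_def tensor_group_def FactGroup_def RCOSETS_def
  using one_in_K by auto

lemma tensor_one_surj:
  assumes "X \<in> carrier T"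
  obtains x where "x \<in> carrier M" "X = tensor_one x"
proof -
  obtain u where u: "u \<in> carrier G" "X = relations #>\<^bsub>G\<^esub> u"
    using assms unfolding tensor_gmodule_def tensor_group_def FactGroup_def RCOSETS_def by auto
  then show thesis using tensor_with_one[OF u(1)] coset_eq_iff that by (metis tensor_one_def)
qed

lemma tensor_one_add:
  assumes x: "x \<in> carrier M" and y: "y \<in> carrier M"
  shows "tensor_one (x \<oplus>\<^bsub>M\<^esub> y) = tensor_one x \<oplus>\<^bsub>T\<^esub> tensor_one y"
proof -
  have "normal relations G"
    using comm_group.subgroup_imp_normal[OF G_comm relations_subgroup] .
  then have "tensor_one x \<oplus>\<^bsub>T\<^esub> tensor_one y = relations #>\<^bsub>G\<^esub> (frag_of (x, 1) + frag_of (y, 1))"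
    using normal.rcos_sum[of relations G "frag_of (x, 1)" "frag_of (y, 1)"] x y one_in_K
    by (simp add: tensor_one_def tensor_gmodule_def tensor_group_def FactGroup_def)
  then show ?thesis
    unfolding tensor_one_def using relation_left[OF x y one_in_K] by (simp add: coset_eq_iff algebra_simps)
qed

text \<open>
  Together with additivity and surjectivity, this identifies the tensor product of \<open>M\<close> with
  the integers modulo \<open>p\<close> as \<open>M / p M\<close>.
\<close>
lemma tensor_one_eq_iff:
  assumes x: "x \<in> carrier M" and y: "y \<in> carrier M"
  shows "tensor_one x = tensor_one y \<longleftrightarrow> (\<exists>z \<in> carrier M. x = y \<oplus>\<^bsub>M\<^esub> of_nat p \<odot>\<^bsub>M\<^esub> z)"
proof
  assume "tensor_one x = tensor_one y"
  then have rel: "frag_of (x, 1) - frag_of (y, 1) \<in> relations" unfolding tensor_one_def coset_eq_iff .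
  let ?w = "x \<ominus>\<^bsub>M\<^esub> y"
  have w: "?w \<in> carrier M" "?w \<oplus>\<^bsub>M\<^esub> y = x" using x y by (auto simp: M.minus_eq M.a_assoc M.l_neg)
  have "(frag_of (x, 1) - frag_of (y, 1)) - (frag_of (?w \<oplus>\<^bsub>M\<^esub> y, 1) - frag_of (?w, 1) - frag_of (y, 1)) \<in> relations"
    by (rule relations_diff[OF rel relation_left[OF w(1) y one_in_K]])
  then have "frag_of (?w, 1) \<in> relations" unfolding w(2) by simp
  then obtain z where "z \<in> carrier M" "?w = of_nat p \<odot>\<^bsub>M\<^esub> z" using tensor_kernel w(1) by blast
  then show "\<exists>z \<in> carrier M. x = y \<oplus>\<^bsub>M\<^esub> of_nat p \<odot>\<^bsub>M\<^esub> z"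
    using w y M.a_comm by metis
next
  assume "\<exists>z \<in> carrier M. x = y \<oplus>\<^bsub>M\<^esub> of_nat p \<odot>\<^bsub>M\<^esub> z"
  then obtain z where z: "z \<in> carrier M" "x = y \<oplus>\<^bsub>M\<^esub> of_nat p \<odot>\<^bsub>M\<^esub> z" by blast
  have "(frag_of (x, 1) - frag_of (y, 1) - frag_of (of_nat p \<odot>\<^bsub>M\<^esub> z, 1)) + frag_of (of_nat p \<odot>\<^bsub>M\<^esub> z, 1) \<in> relations"
    using relation_left[OF y of_nat_smult_closed[OF z(1), of p] one_in_K] tensor_p_multiple[OF z(1)]
    unfolding z(2) by (rule relations_add)
  then show "tensor_one x = tensor_one y" unfolding tensor_one_def coset_eq_iff by simp
qed

text \<open>
  The induced endomorphism maps relations to relations, so the union that defines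
  \<open>tensor_map\<close> is a union of copies of a single coset.
\<close>
lemma tensor_one_act:
  assumes h: "h \<in> carrier H" and x: "x \<in> carrier M"
  shows "act T h (tensor_one x) = tensor_one (act M h x)"
proof -
  let ?E = "frag_extend (\<lambda>(x, a). frag_of (act M h x, id a))"
  have E: "?E r \<in> relations" if "r \<in> relations" for r
    using that
  proof (induction r rule: relations_induct)
    case zero
    then show ?case using relations_zero by simp
  next
    case (left x y a)
    then show ?case
      using relation_left[of "act M h x" "act M h y" a] h
      by (simp add: frag_extend_diff act_add act_closed)
  next
    case (right x a b)
    then show ?case
      using relation_right[of "act M h x" a b] h by (simp add: frag_extend_diff act_closed)
  next
    case (diff r s)
    then show ?case by (simp add: frag_extend_diff relations_diff)
  qed
  have "relations #>\<^bsub>G\<^esub> ?E u = tensor_one (act M h x)" if u: "u \<in> tensor_one x" for u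
  proof -
    obtain r where r: "r \<in> relations" "u = r + frag_of (x, 1)" using u
      by (auto simp: tensor_one_def r_coset_def)
    then have "?E u - frag_of (act M h x, 1) = ?E r" by (simp add: frag_extend_add)
    then show ?thesis unfolding tensor_one_def coset_eq_iff using E[OF r(1)] by simp
  qed
  moreover have "frag_of (x, 1) \<in> tensor_one x"
    using relations_zero by (force simp: tensor_one_def r_coset_def)
  ultimately have "(\<Union>u\<in>tensor_one x. relations #>\<^bsub>G\<^esub> ?E u) = tensor_one (act M h x)" by blast
  then show ?thesis by (simp add: tensor_gmodule_def tensor_map_def)
qed

end

section \<open>Invertible modules are determined by their reduction\<close>

theorem proposition4p11:
  fixes p :: nat
    and H :: "('h, 'j) monoid_scheme"
    and N1 :: "(rat, 'm, 'h, 'k) gmodule_scheme"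
    and N2 :: "(rat, 'n, 'h, 'l) gmodule_scheme"
  assumes "prime p"
    and "group H" and "finite (carrier H)"
    and "invertible_gmodule TYPE('c) (Z_loc p) H N1"
    and "invertible_gmodule TYPE('d) (Z_loc p) H N2"
    and "gmodule_isomorphic (residue_ring (int p)) H
           (tensor_gmodule N1 (residue_ring (int p))) (tensor_gmodule N2 (residue_ring (int p)))"
  shows "gmodule_isomorphic (Z_loc p) H N1 N2"
proof -
  note p = \<open>prime p\<close>
  let ?R = "Z_loc p" and ?K = "residue_ring (int p)"
  let ?T1 = "tensor_gmodule N1 ?K" and ?T2 = "tensor_gmodule N2 ?K"
  interpret N1: local_gmodule p H N1
    using assms(4) p by (simp add: local_gmodule_def local_gmodule_axioms_def invertible_gmodule_def)
  interpret N2: local_gmodule p H N2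
    using assms(5) p by (simp add: local_gmodule_def local_gmodule_axioms_def invertible_gmodule_def)
  obtain X1 :: "'c set" and \<alpha>1 e1 c1 where frame1: "permutation_frame ?R H N1 X1 \<alpha>1 e1 c1"
    using permutation_frame_of_invertible[OF assms(4)] by blast
  obtain X2 :: "'d set" and \<alpha>2 e2 c2 where frame2: "permutation_frame ?R H N2 X2 \<alpha>2 e2 c2"
    using permutation_frame_of_invertible[OF assms(5)] by blast
  obtain F where F: "F \<in> equivariant_maps ?K H ?T1 ?T2" and bij: "bij_betw F (carrier ?T1) (carrier ?T2)"
    using assms(6) unfolding gmodule_isomorphic_iff by blast
  note F_closed = equivariant_maps_closed[OF F] and F_add = equivariant_maps_add[OF F]
    and F_act = equivariant_maps_act[OF F]
  define \<rho> where "\<rho> x y \<longleftrightarrow> F (N1.tensor_one x) = N2.tensor_one y" for x y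
  have p_closed: "of_nat p \<in> carrier ?R" by (rule Z_loc_of_nat[OF p])
  have add: "\<rho> (x \<oplus>\<^bsub>N1\<^esub> x') (y \<oplus>\<^bsub>N2\<^esub> y')"
    if "x \<in> carrier N1" "y \<in> carrier N2" "x' \<in> carrier N1" "y' \<in> carrier N2" "\<rho> x y" "\<rho> x' y'" for x y x' y'
    using that F_add N1.tensor_one_closed by (simp add: \<rho>_def N1.tensor_one_add N2.tensor_one_add)
  \<comment> \<open>If \<open>F\<close> sends the zero tensor to the class of \<open>y\<close>, then \<open>2 y\<close> and \<open>y\<close> have the same class.\<close>
  have zero: "F (N1.tensor_one \<zero>\<^bsub>N1\<^esub>) = N2.tensor_one \<zero>\<^bsub>N2\<^esub>"
  proof -
    obtain y where y: "y \<in> carrier N2" "F (N1.tensor_one \<zero>\<^bsub>N1\<^esub>) = N2.tensor_one y"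
      using N2.tensor_one_surj F_closed N1.tensor_one_closed N1.M.zero_closed by metis
    then have "\<rho> (\<zero>\<^bsub>N1\<^esub> \<oplus>\<^bsub>N1\<^esub> \<zero>\<^bsub>N1\<^esub>) (y \<oplus>\<^bsub>N2\<^esub> y)" by (intro add) (auto simp: \<rho>_def)
    then have "N2.tensor_one (y \<oplus>\<^bsub>N2\<^esub> y) = N2.tensor_one y" using y by (simp add: \<rho>_def)
    then obtain z where z: "z \<in> carrier N2" "y \<oplus>\<^bsub>N2\<^esub> y = y \<oplus>\<^bsub>N2\<^esub> of_nat p \<odot>\<^bsub>N2\<^esub> z"
      using N2.tensor_one_eq_iff[of "y \<oplus>\<^bsub>N2\<^esub> y" y] y by auto
    then have "y = \<zero>\<^bsub>N2\<^esub> \<oplus>\<^bsub>N2\<^esub> of_nat p \<odot>\<^bsub>N2\<^esub> z" using y p_closed by simp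
    then have "N2.tensor_one y = N2.tensor_one \<zero>\<^bsub>N2\<^esub>" using N2.tensor_one_eq_iff[of y "\<zero>\<^bsub>N2\<^esub>"] y z by blast
    then show ?thesis using y by simp
  qed
  have smult_nat: "\<rho> (of_nat k \<odot>\<^bsub>N1\<^esub> x) (of_nat k \<odot>\<^bsub>N2\<^esub> y)"
    if xy: "x \<in> carrier N1" "y \<in> carrier N2" "\<rho> x y" for k x y
  proof (induction k)
    case 0
    have "0 \<odot>\<^bsub>N1\<^esub> x = \<zero>\<^bsub>N1\<^esub>" "0 \<odot>\<^bsub>N2\<^esub> y = \<zero>\<^bsub>N2\<^esub>"
      using N1.smult_l_null[OF xy(1)] N2.smult_l_null[OF xy(2)] by auto
    then show ?case using zero by (simp add: \<rho>_def)
  next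
    case (Suc k)
    then show ?case
      unfolding N1.of_nat_Suc_smult[OF xy(1)] N2.of_nat_Suc_smult[OF xy(2)]
      by (intro add N1.of_nat_smult_closed N2.of_nat_smult_closed xy)
  qed
  \<comment> \<open>A scalar is congruent to a natural number modulo \<open>p\<close>, so additivity of \<open>F\<close> suffices.\<close>
  have smult: "\<rho> (r \<odot>\<^bsub>N1\<^esub> x) (r \<odot>\<^bsub>N2\<^esub> y)"
    if r: "r \<in> carrier ?R" and xy: "x \<in> carrier N1" "y \<in> carrier N2" "\<rho> x y" for r x y
  proof -
    obtain k s where s: "s \<in> carrier ?R" "r = of_nat k + of_nat p * s" using Z_loc_residue[OF p r] .
    have k: "of_nat k \<in> carrier ?R" by (rule Z_loc_of_nat[OF p])
    have "r \<odot>\<^bsub>N1\<^esub> x = of_nat k \<odot>\<^bsub>N1\<^esub> x \<oplus>\<^bsub>N1\<^esub> of_nat p \<odot>\<^bsub>N1\<^esub> (s \<odot>\<^bsub>N1\<^esub> x)"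
      using N1.smult_l_distr[of "of_nat k" "of_nat p * s" x] N1.smult_assoc1[of "of_nat p" s x]
        k s p_closed xy Z_loc_mult_closed[OF p] by simp
    then have "N1.tensor_one (r \<odot>\<^bsub>N1\<^esub> x) = N1.tensor_one (of_nat k \<odot>\<^bsub>N1\<^esub> x)"
      using N1.tensor_one_eq_iff[of "r \<odot>\<^bsub>N1\<^esub> x" "of_nat k \<odot>\<^bsub>N1\<^esub> x"] r k s(1) xy by blast
    moreover have "r \<odot>\<^bsub>N2\<^esub> y = of_nat k \<odot>\<^bsub>N2\<^esub> y \<oplus>\<^bsub>N2\<^esub> of_nat p \<odot>\<^bsub>N2\<^esub> (s \<odot>\<^bsub>N2\<^esub> y)"
      using N2.smult_l_distr[of "of_nat k" "of_nat p * s" y] N2.smult_assoc1[of "of_nat p" s y]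
        k s p_closed xy Z_loc_mult_closed[OF p] by simp
    then have "N2.tensor_one (r \<odot>\<^bsub>N2\<^esub> y) = N2.tensor_one (of_nat k \<odot>\<^bsub>N2\<^esub> y)"
      using N2.tensor_one_eq_iff[of "r \<odot>\<^bsub>N2\<^esub> y" "of_nat k \<odot>\<^bsub>N2\<^esub> y"] r k s(1) xy by blast
    ultimately show ?thesis using smult_nat[OF xy, of k] by (simp add: \<rho>_def)
  qed
  have "residue_correspondence ?R H N1 X1 \<alpha>1 e1 c1 N2 X2 \<alpha>2 e2 c2 (of_nat p) \<rho>"
  proof (intro residue_correspondence.intro residue_correspondence_axioms.intro frame1 frame2)
    show "of_nat p \<in> carrier ?R" by (rule p_closed)
    show "\<exists>y\<in>carrier N2. \<rho> x y" if "x \<in> carrier N1" for x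
      unfolding \<rho>_def using N2.tensor_one_surj F_closed N1.tensor_one_closed that by metis
    show "\<exists>x\<in>carrier N1. \<rho> x y" if y: "y \<in> carrier N2" for y
    proof -
      have "N2.tensor_one y \<in> F ` carrier ?T1"
        using bij N2.tensor_one_closed[OF y] by (simp add: bij_betw_def)
      then obtain t where t: "t \<in> carrier ?T1" "N2.tensor_one y = F t" by (rule imageE) simp
      obtain x where "x \<in> carrier N1" "t = N1.tensor_one x" by (rule N1.tensor_one_surj[OF t(1)])
      then show ?thesis unfolding \<rho>_def using t(2) by auto
    qed
    show "\<rho> (act N1 h x) (act N2 h y)"
      if "h \<in> carrier H" "x \<in> carrier N1" "y \<in> carrier N2" "\<rho> x y" for h x y
      using that F_act[OF that(1) N1.tensor_one_closed[OF that(2)]]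
      by (simp add: \<rho>_def N1.tensor_one_act N2.tensor_one_act)
    show "\<rho> x \<zero>\<^bsub>N2\<^esub> \<longleftrightarrow> (\<exists>z\<in>carrier N1. x = of_nat p \<odot>\<^bsub>N1\<^esub> z)" if x: "x \<in> carrier N1" for x
    proof -
      have "\<rho> x \<zero>\<^bsub>N2\<^esub> \<longleftrightarrow> F (N1.tensor_one x) = F (N1.tensor_one \<zero>\<^bsub>N1\<^esub>)" using zero by (simp add: \<rho>_def)
      also have "\<dots> \<longleftrightarrow> N1.tensor_one x = N1.tensor_one \<zero>\<^bsub>N1\<^esub>"
        using bij N1.tensor_one_closed x by (intro inj_on_eq_iff) (auto simp: bij_betw_def)
      finally show ?thesis using N1.tensor_one_eq_iff[of x "\<zero>\<^bsub>N1\<^esub>"] x p_closed by simp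
    qed
    show "\<rho> \<zero>\<^bsub>N1\<^esub> y \<longleftrightarrow> (\<exists>z\<in>carrier N2. y = of_nat p \<odot>\<^bsub>N2\<^esub> z)" if y: "y \<in> carrier N2" for y
    proof -
      have "\<rho> \<zero>\<^bsub>N1\<^esub> y \<longleftrightarrow> N2.tensor_one y = N2.tensor_one \<zero>\<^bsub>N2\<^esub>" using zero by (auto simp: \<rho>_def)
      then show ?thesis using N2.tensor_one_eq_iff[of y "\<zero>\<^bsub>N2\<^esub>"] y p_closed by simp
    qed
  qed (use add smult in auto)
  then show ?thesis
  proof (rule residue_correspondence.residue_correspondence_lifts)
    show "a = \<zero>\<^bsub>?R\<^esub>" if "of_nat p \<otimes>\<^bsub>?R\<^esub> a = \<zero>\<^bsub>?R\<^esub>" for a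
      using that prime_gt_0_nat[OF p] by simp
    show "a = \<zero>\<^bsub>?R\<^esub>" if "a \<in> carrier ?R"
      "\<forall>k::nat. \<exists>b\<in>carrier ?R. a = of_nat p [^]\<^bsub>?R\<^esub> k \<otimes>\<^bsub>?R\<^esub> b" for a
      using Z_loc_separated[OF p that] by simp
    show "\<one>\<^bsub>?R\<^esub> \<ominus>\<^bsub>?R\<^esub> of_nat p \<otimes>\<^bsub>?R\<^esub> a \<in> Units ?R" if "a \<in> carrier ?R" for a
      using Z_loc_one_minus_unit[OF p that] .
  qed
qed

end
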